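(* Let $A=\mathrm{Op}(\sigma_A)$ with $\sigma_A\in S^m(\mathbb{Z}^n\times\mathbb{T}^n)$ be such that its symbol satisfies $\sigma_A(k,x)\ge0$ for all $(k,x)\in\mathbb{Z}^n\times\mathbb{T}^n$. Then there exists $C<\infty$ such that $$\mathrm{Re}\,(Af,f)_{\ell^2(\mathbb{Z}^n)}\ge-C\,\|f\|^2_{\ell^2_{\frac{m-1}{2}}(\mathbb{Z}^n)}$$ for all $f\in\ell^2_{\frac{m-1}{2}}(\mathbb{Z}^n)$.
   Context: $\mathbb{T}^n=\mathbb{R}^n/\mathbb{Z}^n$. For suitable $f:\mathbb{Z}^n\to\mathbb{C}$, $\widehat f(x)=\sum_{k\in\mathbb{Z}^n}e^{-2\pi i k\cdot x}f(k)$ and $\mathrm{Op}(\sigma)f(k)=\int_{\mathbb{T}^n}e^{2\pi i k\cdot x}\sigma(k,x)\widehat f(x)\,dx$. The pairing is $(g,f)_{\ell^2(\mathbb{Z}^n)}=\sum_{k\in\mathbb{Z}^n} g(k)\overline{f(k)}$. For $s\in\mathbb{R}$, $\ell^2_s(\mathbb{Z}^n)$ is the space of $f:\mathbb{Z}^n\to\mathbb{C}$ with $\|f\|_{\ell^2_s(\mathbb{Z}^n)}=\big(\sum_{k\in\mathbb{Z}^n}(1+|k|)^{2s}|f(k)|^2\big)^{1/2}<\infty$. $\Delta^\alpha=\Delta_1^{\alpha_1}\cdots\Delta_n^{\alpha_n}$ with $\Delta_j\tau(k)=\tau(k+v_j)-\tau(k)$, $v_j$ the $j$-th standard unit vector;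 $D_x^{(\alpha)}=D_{x_1}^{(\alpha_1)}\cdots D_{x_n}^{(\alpha_n)}$ with $D_{x_j}^{(0)}=I$ and $D_{x_j}^{(\ell)}=\prod_{r=0}^{\ell}\big(\frac{1}{2\pi i}\frac{\partial}{\partial x_j}-r\big)$ for $\ell\in\mathbb{N}$. $S^m(\mathbb{Z}^n\times\mathbb{T}^n)=S^m_{1,0}(\mathbb{Z}^n\times\mathbb{T}^n)$, $m\in\mathbb{R}$, consists of $\sigma:\mathbb{Z}^n\times\mathbb{T}^n\to\mathbb{C}$ with $\sigma(k,\cdot)\in C^\infty(\mathbb{T}^n)$ for all $k$ and such that for all multi-indices $\alpha,\beta$ there is $C_{\alpha,\beta}>0$ with $|D_x^{(\beta)}\Delta_k^\alpha\sigma(k,x)|\le C_{\alpha,\beta}(1+|k|)^{m-|\alpha|}$ for all $(k,x)$. *)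

theory Defs
  imports "HOL-Analysis.Analysis"
begin

text \<open>The lattice \<open>\<int>\<^sup>n\<close> is \<open>int ^ 'n\<close>, multi-indices are elements of \<open>nat ^ 'n\<close>, and functions on the
  torus \<open>\<real>\<^sup>n/\<int>\<^sup>n\<close> are \<open>\<int>\<^sup>n\<close>-periodic functions on \<open>real ^ 'n\<close>.\<close>

definition rvec :: "int ^ 'n \<Rightarrow> real ^ 'n" where
  "rvec k = (\<chi> j. real_of_int (k $ j))"

abbreviation lnorm :: "int ^ 'n::finite \<Rightarrow> real" where
  "lnorm k \<equiv> norm (rvec k)"

definition mi_order :: "nat ^ 'n::finite \<Rightarrow> nat" where
  "mi_order \<alpha> = (\<Sum>j\<in>UNIV. \<alpha> $ j)"

text \<open>Some fixed enumeration \<open>j\<^sub>1, \<dots>, j\<^sub>n\<close> of the coordinates. It only fixes the order in which the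
  operators belonging to different coordinates are composed; these operators commute
  (the derivatives on smooth functions).\<close>

definition coords :: "'n::finite list" where
  "coords = (SOME js. distinct js \<and> set js = UNIV)"

lemma distinct_coords: "distinct (coords :: 'n::finite list)"
  and set_coords: "set (coords :: 'n::finite list) = UNIV"
proof -
  have "\<exists>js :: 'n list. distinct js \<and> set js = UNIV"
    using finite_distinct_list[of "UNIV :: 'n set"] by auto
  from someI_ex[OF this]
  show "distinct (coords :: 'n list)" "set (coords :: 'n list) = UNIV"
    unfolding coords_def by blast+
qed


section \<open>Difference and differential operators\<close>

definition diff_op :: "'n::finite \<Rightarrow> (int ^ 'n \<Rightarrow> complex) \<Rightarrow> int ^ 'n \<Rightarrow> complex" where
  "diff_op j \<tau> k = \<tau> (k + axis j 1) - \<tau> k"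

definition Diff :: "nat ^ 'n::finite \<Rightarrow> (int ^ 'n \<Rightarrow> complex) \<Rightarrow> int ^ 'n \<Rightarrow> complex" where
  "Diff \<alpha> = foldr (\<lambda>j. diff_op j ^^ (\<alpha> $ j)) coords"

definition partial :: "'n::finite \<Rightarrow> (real ^ 'n \<Rightarrow> complex) \<Rightarrow> real ^ 'n \<Rightarrow> complex" where
  "partial j u x = vector_derivative (\<lambda>t. u (x + t *\<^sub>R axis j 1)) (at 0)"

text \<open>\<open>shifted_D j r\<close> is \<open>(2\<pi>i)\<^sup>-\<^sup>1 \<partial>\<^sub>j - r\<close>. In \<open>D1 j l\<close> with \<open>l \<ge> 1\<close> the product runs over
  \<open>r = 0, \<dots>, l\<close> inclusively (so it has \<open>l + 1\<close> factors), whereas \<open>D1 j 0\<close> is the identity.\<close>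

definition shifted_D :: "'n::finite \<Rightarrow> nat \<Rightarrow> (real ^ 'n \<Rightarrow> complex) \<Rightarrow> real ^ 'n \<Rightarrow> complex" where
  "shifted_D j r u x = 1 / (2 * of_real pi * \<i>) * partial j u x - of_nat r * u x"

definition D1 :: "'n::finite \<Rightarrow> nat \<Rightarrow> (real ^ 'n \<Rightarrow> complex) \<Rightarrow> real ^ 'n \<Rightarrow> complex" where
  "D1 j l = (if l = 0 then id else foldr (shifted_D j) [0..<Suc l])"

definition D :: "nat ^ 'n::finite \<Rightarrow> (real ^ 'n \<Rightarrow> complex) \<Rightarrow> real ^ 'n \<Rightarrow> complex" where
  "D \<beta> = foldr (\<lambda>j. D1 j (\<beta> $ j)) coords"


section \<open>Symbol classes\<close>

text \<open>\<open>C\<^sup>\<infinity>\<close>: all iterated partial derivatives are (Frechet) differentiable, hence continuous.\<close>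

definition smooth :: "(real ^ 'n::finite \<Rightarrow> complex) \<Rightarrow> bool" where
  "smooth u \<longleftrightarrow> (\<forall>js. foldr partial js u differentiable_on UNIV)"

definition periodic :: "(real ^ 'n::finite \<Rightarrow> complex) \<Rightarrow> bool" where
  "periodic u \<longleftrightarrow> (\<forall>x l. u (x + rvec l) = u x)"

definition symbol_class :: "real \<Rightarrow> (int ^ 'n::finite \<Rightarrow> real ^ 'n \<Rightarrow> complex) set" where
  "symbol_class m = {\<sigma>.
     (\<forall>k. smooth (\<sigma> k) \<and> periodic (\<sigma> k)) \<and>
     (\<forall>\<alpha> \<beta>. \<exists>C>0. \<forall>k x.
        cmod (D \<beta> (\<lambda>y. Diff \<alpha> (\<lambda>l. \<sigma> l y) k) x)
          \<le> C * (1 + lnorm k) powr (m - real (mi_order \<alpha>)))}"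


section \<open>Sequence spaces\<close>

definition l2s :: "real \<Rightarrow> (int ^ 'n::finite \<Rightarrow> complex) set" where
  "l2s s = {f. (\<lambda>k. (1 + lnorm k) powr (2 * s) * (cmod (f k))\<^sup>2) summable_on UNIV}"

definition l2s_norm :: "real \<Rightarrow> (int ^ 'n::finite \<Rightarrow> complex) \<Rightarrow> real" where
  "l2s_norm s f = sqrt (\<Sum>\<^sub>\<infinity>k. (1 + lnorm k) powr (2 * s) * (cmod (f k))\<^sup>2)"

text \<open>The sum defining the pairing is absolutely convergent or else, by the convention of
  \<^const>\<open>infsum\<close>, takes the value \<open>0\<close>.\<close>

definition l2_pairing :: "(int ^ 'n::finite \<Rightarrow> complex) \<Rightarrow> (int ^ 'n \<Rightarrow> complex) \<Rightarrow> complex" where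
  "l2_pairing g f = (\<Sum>\<^sub>\<infinity>k. g k * cnj (f k))"


section \<open>Fourier transform and pseudo-difference operators\<close>

definition torus_integral :: "(real ^ 'n::finite \<Rightarrow> complex) \<Rightarrow> complex" where
  "torus_integral u = integral (cbox 0 One) u"

definition echar :: "int ^ 'n::finite \<Rightarrow> real ^ 'n \<Rightarrow> complex" where
  "echar k x = exp (2 * of_real pi * \<i> * of_real (rvec k \<bullet> x))"

definition fourier :: "(int ^ 'n::finite \<Rightarrow> complex) \<Rightarrow> real ^ 'n \<Rightarrow> complex" where
  "fourier f x = (\<Sum>\<^sub>\<infinity>k. exp (- 2 * of_real pi * \<i> * of_real (rvec k \<bullet> x)) * f k)"

text \<open>For \<open>f\<close> in a space \<open>\<ell>\<^sup>2\<^sub>s\<close>, the series \<^const>\<open>fourier\<close> need not converge pointwise and the Fourier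
  transform of \<open>f\<close> is in general only a periodic distribution. \<open>fourier_dist f \<phi>\<close> is the value of
  this distribution on a test function \<open>\<phi>\<close>, i.e. the meaning of \<open>\<integral> \<phi>(x) F(x) dx\<close>, \<open>F\<close> the Fourier transform of \<open>f\<close>: the
  transform is applied termwise. The operator \<open>Op \<sigma>\<close> is then the usual formula
  \<open>\<integral> exp(2\<pi>i k\<bullet>x) \<sigma>(k,x) F(x) dx\<close> in this sense. The lemma \<open>Op_eq_integral\<close> below shows that it is
  literally this integral whenever \<open>f\<close> is absolutely summable.\<close>

definition fourier_dist ::
    "(int ^ 'n::finite \<Rightarrow> complex) \<Rightarrow> (real ^ 'n \<Rightarrow> complex) \<Rightarrow> complex" where
  "fourier_dist f \<phi> =
     (\<Sum>\<^sub>\<infinity>l. torus_integral (\<lambda>x. \<phi> x * (exp (- 2 * of_real pi * \<i> * of_real (rvec l \<bullet> x)) * f l)))"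

definition Op :: "(int ^ 'n::finite \<Rightarrow> real ^ 'n \<Rightarrow> complex)
    \<Rightarrow> (int ^ 'n \<Rightarrow> complex) \<Rightarrow> int ^ 'n \<Rightarrow> complex" where
  "Op \<sigma> f k = fourier_dist f (\<lambda>x. echar k x * \<sigma> k x)"

lemma fourier_dist_eq_integral:
  fixes f :: "int ^ 'n::finite \<Rightarrow> complex"
  assumes f: "(\<lambda>k. cmod (f k)) summable_on UNIV" and \<phi>: "continuous_on (cbox 0 One) \<phi>"
  shows "fourier_dist f \<phi> = torus_integral (\<lambda>x. \<phi> x * fourier f x)"
proof -
  define g where "g = (\<lambda>l x. \<phi> x * (exp (- 2 * of_real pi * \<i> * of_real (rvec l \<bullet> x)) * f l))"
  have cont: "continuous_on (cbox 0 One) (g l)" for l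
    unfolding g_def by (intro continuous_intros \<phi>)
  obtain B where B: "cmod (\<phi> x) \<le> B" if "x \<in> cbox 0 One" for x
    using compact_imp_bounded[OF compact_continuous_image[OF \<phi> compact_cbox]]
    unfolding bounded_iff by auto
  have ncis: "cmod (exp (- 2 * of_real pi * \<i> * of_real (rvec l \<bullet> x))) = 1"
    for l :: "int ^ 'n" and x
    by (simp add: norm_exp_eq_Re)
  have "uniform_limit (cbox 0 One) (\<lambda>F x. \<Sum>l\<in>F. g l x) (\<lambda>x. \<Sum>\<^sub>\<infinity>l. g l x)
          (finite_subsets_at_top UNIV)"
  proof (rule Weierstrass_m_test_general)
    show "cmod (g l x) \<le> B * cmod (f l)" if "x \<in> cbox 0 One" for l x
      using B[OF that] unfolding g_def norm_mult ncis by (simp add: mult_right_mono)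
    show "(\<lambda>l. B * cmod (f l)) summable_on UNIV"
      by (intro summable_on_cmult_right f)
  qed
  then obtain I J where IJ:
      "\<And>F. ((\<lambda>x. \<Sum>l\<in>F. g l x) has_integral I F) (cbox 0 One)"
      "((\<lambda>x. \<Sum>\<^sub>\<infinity>l. g l x) has_integral J) (cbox 0 One)"
      "(I \<longlongrightarrow> J) (finite_subsets_at_top UNIV)"
    by (rule uniform_limit_integral_cbox)
       (auto intro!: continuous_on_sum cont)
  have "I F = (\<Sum>l\<in>F. torus_integral (g l))" if "finite F" for F
  proof -
    have "((\<lambda>x. \<Sum>l\<in>F. g l x) has_integral (\<Sum>l\<in>F. torus_integral (g l))) (cbox 0 One)"
      unfolding torus_integral_def
      by (intro has_integral_sum that integrable_integral integrable_continuous cont)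
    then show ?thesis
      using IJ(1) has_integral_unique by blast
  qed
  then have "((\<lambda>F. \<Sum>l\<in>F. torus_integral (g l)) \<longlongrightarrow> J) (finite_subsets_at_top UNIV)"
    using IJ(3) by (rule_tac Lim_transform_eventually) 
      (auto intro!: eventually_finite_subsets_at_top_weakI)
  then have "fourier_dist f \<phi> = J"
    unfolding fourier_dist_def g_def[symmetric]
    by (intro infsumI) (simp add: has_sum_def g_def)
  moreover have "torus_integral (\<lambda>x. \<phi> x * fourier f x) = J"
  proof -
    have "(\<Sum>\<^sub>\<infinity>l. g l x) = \<phi> x * fourier f x" for x
      unfolding g_def fourier_def by (rule infsum_cmult_right')
    then show ?thesis
      using IJ(2) unfolding torus_integral_def by (simp add: integral_unique)
  qed
  ultimately show ?thesis by simp
qed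

lemma Op_eq_integral:
  fixes f :: "int ^ 'n::finite \<Rightarrow> complex"
  assumes "(\<lambda>k. cmod (f k)) summable_on UNIV" and "smooth (\<sigma> k)"
  shows "Op \<sigma> f k = torus_integral (\<lambda>x. echar k x * \<sigma> k x * fourier f x)"
proof -
  have "foldr partial [] (\<sigma> k) differentiable_on UNIV"
    using assms(2) unfolding smooth_def by blast
  then have "continuous_on (cbox 0 One) (\<sigma> k)"
    using differentiable_imp_continuous_on continuous_on_subset by fastforce
  then have "continuous_on (cbox 0 One) (\<lambda>x. echar k x * \<sigma> k x)"
    unfolding echar_def by (intro continuous_intros)
  from fourier_dist_eq_integral[OF assms(1) this] show ?thesis
    unfolding Op_def .
qed

end

(* The operator is the matrix a(k, k - l), where a(p, \<xi>) is the Fourier coefficient at \<xi> of \<sigma>(p, _); integration by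
   parts gives rapid decay in \<xi>, with a gain of one power of the weight per difference in p. Following Friedrichs,
   it is compared with the positive matrix whose entries are the sums over p of F(p,k) F(p,l) a(p, k - l), where F(_,k)
   is a unit vector in l^2: a tent around k of radius comparable to the square root of the weight at k. From
   F F' = (F^2 + F'^2 - (F - F')^2) / 2 the difference to the Hermitian part splits into averages of a over even
   weights, which see only second differences, and a term controlled by the l^2 distance of two neighbouring tents.
   Both are of order m - 1, and Schur's test finishes the proof for finitely supported f. The pairing for
   f in l^2_{(m-1)/2} need not converge absolutely on the level of the double sum, so the general case is reached with
   cutoffs, whose commutators with the operator are of order m - 1 uniformly in the cutoff radius. *)

theory Submission
  imports Defs
begin

subsection \<open>Fourier coefficients of smooth functions on the torus\<close>

text \<open>Positivity is available only while the symbol is frozen at one p: the matrix with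
  entries a(p, k - l) is then Toeplitz and represents multiplication by a non-negative function. In
  the operator itself p is the row index k, which destroys both positivity and Hermitian symmetry;
  averaging over p restores them at a price. With tents of radius r, the averages cost r^2 times a
  second difference of order m - 2, the linear term being cancelled by evenness, while two
  neighbouring normalised tents have squared distance about r^(-2), multiplied by a of order m. The
  two costs balance exactly when r^2 is comparable to the weight. A product of two different windows
  is in general even about neither centre, hence the detour through squares. Finally, f is
  controlled at order (m - 1) / 2 while the matrix has order m, so the estimate for finite supports
  does not extend by continuity; truncating the rows alone leaves convergent column sums.\<close>

lemma sum_Basis_nth [simp]: "(\<Sum>b\<in>Basis. (b :: real ^ 'n::finite) $ i) = 1"
proof -
  have "(One :: real ^ 'n) \<bullet> axis i 1 = 1"
    by (rule inner_sum_Basis) (simp add: axis_in_Basis_iff)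
  then show ?thesis by (simp add: inner_axis)
qed

text \<open>The unit cube and its translate share the slab \<open>Q\<close>, where coordinate j lies
  between t and 1. What remains of the cube is \<open>P\<close>, and what remains of the translate
  is \<open>P\<close> moved by a full period.\<close>

lemma torus_integral_translate:
  fixes u :: "real ^ 'n::finite \<Rightarrow> complex"
  assumes cont: "continuous_on UNIV u" and per: "periodic u" and t: "0 \<le> t" "t \<le> 1"
  shows "torus_integral (\<lambda>x. u (x + t *\<^sub>R axis j 1)) = torus_integral u"
proof -
  define e where "e = (axis j 1 :: real ^ 'n)"
  have e: "e \<in> Basis" by (simp add: e_def axis_in_Basis_iff)
  have int: "(u has_integral integral (cbox a b) u) (cbox a b)" for a b
    by (intro integrable_integral integrable_continuous continuous_on_subset[OF cont]) auto
  define P where "P = cbox (0 :: real ^ 'n) (One + (t - 1) *\<^sub>R e)"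
  define Q where "Q = cbox (t *\<^sub>R e) One"
  have e_nth: "e $ i = (if i = j then 1 else 0)" for i
    by (simp add: e_def axis_def)
  have inner_e: "x \<bullet> e = x $ j" for x
    by (simp add: e_def inner_axis)
  have corners: "(\<chi> i. if i = j then min ((One :: real ^ 'n) $ j) t else One $ i) = One + (t - 1) *\<^sub>R e"
    "(\<chi> i. if i = j then max ((0 :: real ^ 'n) $ j) t else 0 $ i) = t *\<^sub>R e"
    "(\<chi> i. if i = j then min ((One + t *\<^sub>R e) $ j) 1 else (One + t *\<^sub>R e) $ i) = One"
    "(\<chi> i. if i = j then max ((t *\<^sub>R e) $ j) 1 else (t *\<^sub>R e) $ i) = e"
    using t by (simp_all add: vec_eq_iff e_nth)
  note split = interval_split_cart[unfolded interval_cbox_cart]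
  have sets: "cbox 0 One \<inter> {x. x \<bullet> e \<le> t} = P" "cbox 0 One \<inter> {x. x \<bullet> e \<ge> t} = Q"
    "cbox (t *\<^sub>R e) (One + t *\<^sub>R e) \<inter> {x. x \<bullet> e \<le> 1} = Q"
    "cbox (t *\<^sub>R e) (One + t *\<^sub>R e) \<inter> {x. x \<bullet> e \<ge> 1} = cbox e (One + t *\<^sub>R e)"
    unfolding P_def Q_def inner_e split corners by (rule refl)+
  have shift: "integral (cbox e (One + t *\<^sub>R e)) u = integral P u"
  proof -
    have "integral (cbox e (One + t *\<^sub>R e)) u
        = integral (cbox (e - e) (One + t *\<^sub>R e - e)) (\<lambda>x. u (x + e))"
      by (rule integral_shift_cbox[symmetric])
    also have "(\<lambda>x. u (x + e)) = u"
    proof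
      fix x
      have "rvec (axis j 1 :: int ^ 'n) = e" by (auto simp: rvec_def e_def axis_def vec_eq_iff)
      with per show "u (x + e) = u x" unfolding periodic_def by metis
    qed
    finally show ?thesis by (simp add: P_def algebra_simps)
  qed
  have "(u has_integral (integral P u + integral Q u)) (cbox 0 One)"
    by (rule has_integral_split[OF _ _ e, where c = t]) (use sets int P_def Q_def in simp_all)
  moreover have "(u has_integral (integral Q u + integral P u)) (cbox (t *\<^sub>R e) (One + t *\<^sub>R e))"
    by (rule has_integral_split[OF _ _ e, where c = 1])
       (simp only: sets, simp add: Q_def int, simp only: sets shift[symmetric] int)
  moreover have "integral (cbox 0 One) (\<lambda>x. u (x + t *\<^sub>R e)) = integral (cbox (t *\<^sub>R e) (One + t *\<^sub>R e)) u"
    using integral_shift_cbox[of "t *\<^sub>R e" "t *\<^sub>R e" "One + t *\<^sub>R e" u] by simp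
  ultimately show ?thesis
    unfolding torus_integral_def e_def[symmetric] by (simp add: integral_unique add.commute)
qed

text \<open>The definition of \<open>partial\<close> differentiates at parameter 0; moving the base
  point along the line gives the derivative at every t, as differentiation under the integral sign
  requires.\<close>

lemma has_vector_derivative_partial:
  fixes u :: "real ^ 'n::finite \<Rightarrow> complex"
  assumes "u differentiable_on UNIV"
  shows "((\<lambda>t. u (x + t *\<^sub>R axis j 1)) has_vector_derivative partial j u (x + t *\<^sub>R axis j 1))
           (at t within S)"
proof -
  have diff: "u differentiable at y" for y
    using assms by (simp add: differentiable_on_def)
  have "((\<lambda>s. u (y + s *\<^sub>R axis j 1)) has_vector_derivative partial j u y) (at 0)" for y
  proof -
    have "(u \<circ> (\<lambda>s::real. y + s *\<^sub>R axis j 1)) differentiable at 0"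
      by (rule differentiable_chain_at) (auto intro!: derivative_intros diff)
    then show ?thesis
      unfolding partial_def comp_def by (simp add: vector_derivative_works)
  qed
  note * = this[of "x + t *\<^sub>R axis j 1"]
  have "((\<lambda>s. u (x + t *\<^sub>R axis j 1 + s *\<^sub>R axis j 1)) \<circ> (\<lambda>r. r - t) has_vector_derivative
      1 *\<^sub>R partial j u (x + t *\<^sub>R axis j 1)) (at t)"
    by (rule vector_diff_chain_at) (auto intro!: derivative_eq_intros * )
  then have "((\<lambda>r. u (x + r *\<^sub>R axis j 1)) has_vector_derivative
      partial j u (x + t *\<^sub>R axis j 1)) (at t)"
    by (simp add: comp_def algebra_simps)
  then show ?thesis by (rule has_vector_derivative_at_within)
qed

lemma partial_eqI:
  assumes "((\<lambda>t. u (x + t *\<^sub>R axis j 1)) has_vector_derivative d) (at 0)"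
  shows "partial j u x = d"
  unfolding partial_def by (rule vector_derivative_at[OF assms])

text \<open>The integral of a translate is constant in t, and differentiating under the integral
  sign at t = 0 gives the claim. The derivative is one-sided because translation invariance is
  available for t in [0, 1].\<close>

lemma torus_integral_partial:
  fixes u :: "real ^ 'n::finite \<Rightarrow> complex"
  assumes diff: "u differentiable_on UNIV" and cont: "continuous_on UNIV (partial j u)"
    and per: "periodic u"
  shows "torus_integral (partial j u) = 0"
proof -
  let ?e = "axis j 1 :: real ^ 'n"
  have u: "continuous_on UNIV u" using diff by (rule differentiable_imp_continuous_on)
  have "((\<lambda>t. torus_integral (\<lambda>x. u (x + t *\<^sub>R ?e))) has_vector_derivative
      torus_integral (\<lambda>x. partial j u (x + 0 *\<^sub>R ?e))) (at 0 within cbox 0 1)"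
    unfolding torus_integral_def
  proof (rule leibniz_rule_vector_derivative)
    show "(\<lambda>x. u (x + t *\<^sub>R ?e)) integrable_on cbox 0 One" for t :: real
      by (intro integrable_continuous continuous_on_compose2[OF u] continuous_intros) auto
    show "continuous_on (cbox 0 1 \<times> cbox 0 One) (\<lambda>(t::real, x). partial j u (x + t *\<^sub>R ?e))"
      unfolding split_beta by (intro continuous_on_compose2[OF cont] continuous_intros) auto
  qed (auto intro: has_vector_derivative_partial[OF diff])
  moreover have "((\<lambda>t. torus_integral (\<lambda>x. u (x + t *\<^sub>R ?e))) has_vector_derivative 0)
      (at 0 within cbox 0 1)"
    by (rule has_vector_derivative_transform[where f = "\<lambda>_. torus_integral u"])
       (auto simp: torus_integral_translate[OF u per])
  ultimately have "torus_integral (\<lambda>x. partial j u (x + 0 *\<^sub>R ?e)) = 0"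
    by (intro vector_derivative_unique_within_closed_interval[of 0 1 0]) auto
  then show ?thesis by simp
qed

section \<open>Smooth periodic functions under the differential operators\<close>

lemma foldr_partial_lincomb:
  assumes "smooth u" "smooth v"
  shows "foldr partial js (\<lambda>x. a * u x + b * v x)
       = (\<lambda>x. a * foldr partial js u x + b * foldr partial js v x)"
proof (induction js)
  case (Cons j js)
  have "partial j (\<lambda>x. a * foldr partial js u x + b * foldr partial js v x) x
      = a * partial j (foldr partial js u) x + b * partial j (foldr partial js v) x" for x
    using has_vector_derivative_partial[of "foldr partial js u" x j 0 UNIV]
      has_vector_derivative_partial[of "foldr partial js v" x j 0 UNIV] assms
    unfolding smooth_def
    by (intro partial_eqI has_vector_derivative_add has_vector_derivative_mult_right) auto
  with Cons.IH show ?case by auto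
qed auto

lemma smooth_lincomb:
  assumes "smooth u" "smooth v"
  shows "smooth (\<lambda>x. a * u x + b * v x)"
proof -
  have "(\<lambda>x. a * foldr partial js u x + b * foldr partial js v x) differentiable_on UNIV" for js
    by (intro differentiable_on_add differentiable_on_mult differentiable_on_const)
       (use assms in \<open>simp_all add: smooth_def\<close>)
  then show ?thesis
    unfolding smooth_def foldr_partial_lincomb[OF assms] by blast
qed

lemma smooth_partial: "smooth u \<Longrightarrow> smooth (partial j u)"
  unfolding smooth_def
proof
  fix js
  assume *: "\<forall>js. foldr partial js u differentiable_on UNIV"
  from *[rule_format, of "js @ [j]"] show "foldr partial js (partial j u) differentiable_on UNIV"
    by simp
qed

lemma smooth_imp_differentiable: "smooth u \<Longrightarrow> u differentiable_on UNIV"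
  by (auto simp: smooth_def dest: spec[of _ "[]"])

lemma smooth_imp_continuous: "smooth u \<Longrightarrow> continuous_on S u"
  by (rule continuous_on_subset[OF differentiable_imp_continuous_on subset_UNIV])
     (rule smooth_imp_differentiable)

lemma periodic_partial:
  assumes "periodic u"
  shows "periodic (partial j u)"
  unfolding periodic_def partial_def
proof (intro allI)
  fix x l
  have "u (x + rvec l + t *\<^sub>R axis j 1) = u (x + t *\<^sub>R axis j 1)" for t
    using assms[unfolded periodic_def, rule_format, of "x + t *\<^sub>R axis j 1" l]
    by (simp add: algebra_simps)
  then show "vector_derivative (\<lambda>t. u (x + rvec l + t *\<^sub>R axis j 1)) (at 0)
      = vector_derivative (\<lambda>t. u (x + t *\<^sub>R axis j 1)) (at 0)"
    by simp
qed

lemma shifted_D_eq: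
  "shifted_D j r u = (\<lambda>x. (1 / (2 * of_real pi * \<i>)) * partial j u x + (- of_nat r) * u x)"
  by (auto simp: shifted_D_def)

lemma smooth_shifted_D: "smooth u \<Longrightarrow> smooth (shifted_D j r u)"
  unfolding shifted_D_eq by (intro smooth_lincomb smooth_partial)

lemma periodic_shifted_D: "periodic u \<Longrightarrow> periodic (shifted_D j r u)"
  using periodic_partial[of u j] by (auto simp: periodic_def shifted_D_def)

section \<open>Fourier coefficients and their decay\<close>

text \<open>The sign in the exponent makes \<open>fcoeff (\<sigma> k) (k - l)\<close> the matrix
  entry of the operator in row k and column l; in the usual normalisation it is the coefficient at
  -\<xi>.\<close>

definition fcoeff :: "(real ^ 'n::finite \<Rightarrow> complex) \<Rightarrow> int ^ 'n \<Rightarrow> complex" where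
  "fcoeff u \<xi> = torus_integral (\<lambda>x. u x * echar \<xi> x)"

lemma continuous_on_echar [continuous_intros]: "continuous_on S (echar \<xi>)"
  unfolding echar_def by (intro continuous_intros)

lemma norm_echar [simp]: "cmod (echar \<xi> x) = 1"
  by (simp add: echar_def norm_exp_eq_Re)

lemma rvec_inner_rvec: "rvec k \<bullet> rvec l = of_int (\<Sum>j\<in>UNIV. k $ j * l $ j)"
  by (simp add: rvec_def inner_vec_def)

lemma periodic_echar: "periodic (echar \<xi>)"
  unfolding periodic_def echar_def
proof (intro allI)
  fix x l
  have "2 * of_real pi * \<i> * of_real (rvec \<xi> \<bullet> (x + rvec l))
      = 2 * of_real pi * \<i> * of_real (rvec \<xi> \<bullet> x)
        + of_int (\<Sum>j\<in>UNIV. \<xi> $ j * l $ j) * (of_real pi * 2) * \<i>"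
    by (simp add: inner_add_right rvec_inner_rvec algebra_simps)
  then show "exp (2 * of_real pi * \<i> * of_real (rvec \<xi> \<bullet> (x + rvec l)))
      = exp (2 * complex_of_real pi * \<i> * of_real (rvec \<xi> \<bullet> x))"
    using exp_plus_2pin[of "2 * of_real pi * \<i> * of_real (rvec \<xi> \<bullet> x)" "\<Sum>j\<in>UNIV. \<xi> $ j * l $ j"]
    by (simp add: mult_ac)
qed

lemma echar_integrable: "continuous_on UNIV u \<Longrightarrow> (\<lambda>x. u x * echar \<xi> x) integrable_on cbox 0 One"
  by (intro integrable_continuous continuous_intros) (auto intro: continuous_on_subset)

lemma fcoeff_lincomb:
  assumes "continuous_on UNIV u" "continuous_on UNIV v"
  shows "fcoeff (\<lambda>x. a * u x + b * v x) \<xi> = a * fcoeff u \<xi> + b * fcoeff v \<xi>"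
proof -
  have "fcoeff (\<lambda>x. a * u x + b * v x) \<xi>
      = integral (cbox 0 One) (\<lambda>x. a * (u x * echar \<xi> x) + b * (v x * echar \<xi> x))"
    unfolding fcoeff_def torus_integral_def by (simp add: algebra_simps)
  also have "\<dots> = a * fcoeff u \<xi> + b * fcoeff v \<xi>"
    using assms[THEN echar_integrable, of \<xi>] unfolding fcoeff_def torus_integral_def
    by (subst integral_add) (auto intro!: integrable_on_mult_right)
  finally show ?thesis .
qed

lemma fcoeff_bound:
  fixes u :: "real ^ 'n::finite \<Rightarrow> complex"
  assumes "continuous_on UNIV u" and B: "\<And>x. cmod (u x) \<le> B"
  shows "cmod (fcoeff u \<xi>) \<le> B"
proof -
  have "0 \<le> B" using B[of 0] norm_ge_zero order_trans by blast
  moreover have "measure lborel (cbox 0 (One :: real ^ 'n)) = 1" by (simp add: content_unit)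
  ultimately show ?thesis
    using integrable_bound[of B "\<lambda>x. u x * echar \<xi> x" 0 One] echar_integrable[OF assms(1), of \<xi>] B
    unfolding fcoeff_def torus_integral_def by (simp add: norm_mult)
qed

lemma partial_mult_echar:
  assumes "u differentiable_on UNIV"
  shows "partial j (\<lambda>x. u x * echar \<xi> x) x
       = (partial j u x + 2 * of_real pi * \<i> * of_int (\<xi> $ j) * u x) * echar \<xi> x"
proof (rule partial_eqI)
  have "((\<lambda>t. echar \<xi> (x + t *\<^sub>R axis j 1)) has_vector_derivative
      (2 * of_real pi * \<i> * of_int (\<xi> $ j)) * echar \<xi> x) (at 0)"
    unfolding echar_def
    by (auto intro!: derivative_eq_intros has_vector_derivative_real_field
        simp: inner_add_right inner_axis rvec_def)
  from has_vector_derivative_mult[OF has_vector_derivative_partial[OF assms, of x j 0 UNIV] this]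
  show "((\<lambda>t. u (x + t *\<^sub>R axis j 1) * echar \<xi> (x + t *\<^sub>R axis j 1)) has_vector_derivative
      (partial j u x + 2 * of_real pi * \<i> * of_int (\<xi> $ j) * u x) * echar \<xi> x) (at 0)"
    by (simp add: algebra_simps)
qed

lemma differentiable_echar: "echar \<xi> differentiable_on UNIV"
proof -
  have "((\<lambda>x. exp (2 * of_real pi * \<i> * of_real (rvec \<xi> \<bullet> x))) has_derivative
      (\<lambda>h. exp (2 * of_real pi * \<i> * of_real (rvec \<xi> \<bullet> x)) * (2 * of_real pi * \<i> * of_real (rvec \<xi> \<bullet> h))))
      (at x)" for x
    by (rule has_derivative_compose[where g = exp, OF _ DERIV_exp[unfolded has_field_derivative_def]])
       (auto intro!: derivative_eq_intros)
  then show ?thesis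
    unfolding differentiable_on_def differentiable_def echar_def by blast
qed

text \<open>Integration by parts on the torus: the derivative of \<open>u\<close> times the
  character has integral zero, without boundary terms.\<close>

lemma fcoeff_partial:
  assumes "smooth u" "periodic u"
  shows "fcoeff (partial j u) \<xi> = - (2 * of_real pi * \<i> * of_int (\<xi> $ j)) * fcoeff u \<xi>"
proof -
  let ?v = "\<lambda>x. u x * echar \<xi> x"
  have d: "u differentiable_on UNIV" by (rule smooth_imp_differentiable[OF assms(1)])
  have eq: "partial j ?v = (\<lambda>x. (1 * partial j u x
      + 2 * of_real pi * \<i> * of_int (\<xi> $ j) * u x) * echar \<xi> x)"
    using partial_mult_echar[OF d] by auto
  have "torus_integral (partial j ?v) = 0"
  proof (rule torus_integral_partial)
    show "?v differentiable_on UNIV"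
      using d differentiable_echar[of \<xi>] unfolding differentiable_on_def
      by (blast intro: differentiable_mult)
    show "continuous_on UNIV (partial j ?v)" unfolding eq
      by (intro continuous_intros smooth_imp_continuous smooth_partial assms)
    show "periodic ?v" using assms(2) periodic_echar[of \<xi>] by (auto simp: periodic_def)
  qed
  moreover have "torus_integral (partial j ?v)
      = 1 * fcoeff (partial j u) \<xi> + 2 * of_real pi * \<i> * of_int (\<xi> $ j) * fcoeff u \<xi>"
    unfolding eq using assms
    by (subst fcoeff_lincomb[symmetric])
       (auto simp: fcoeff_def intro!: smooth_imp_continuous smooth_partial)
  ultimately show ?thesis by (simp add: eq_neg_iff_add_eq_0)
qed

lemma fcoeff_shifted_D:
  assumes "smooth u" "periodic u"
  shows "fcoeff (shifted_D j r u) \<xi> = (- of_int (\<xi> $ j) - of_nat r) * fcoeff u \<xi>"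
proof -
  have "fcoeff (shifted_D j r u) \<xi> = 1 / (2 * of_real pi * \<i>) * fcoeff (partial j u) \<xi> + - of_nat r * fcoeff u \<xi>"
    unfolding shifted_D_eq using assms
    by (intro fcoeff_lincomb smooth_imp_continuous smooth_partial)
  then show ?thesis
    unfolding fcoeff_partial[OF assms] by (simp add: left_diff_distrib)
qed

lemma fcoeff_foldr_shifted_D:
  assumes "smooth u" "periodic u"
  shows "smooth (foldr (shifted_D j) rs u) \<and> periodic (foldr (shifted_D j) rs u) \<and>
    fcoeff (foldr (shifted_D j) rs u) \<xi> = (\<Prod>r\<leftarrow>rs. - of_int (\<xi> $ j) - of_nat r) * fcoeff u \<xi>"
  by (induction rs) (use assms in \<open>auto intro: smooth_shifted_D periodic_shifted_D simp: fcoeff_shifted_D\<close>)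

lemma D1_0 [simp]: "D1 j 0 = id"
  by (simp add: D1_def)

lemma D_0: "D 0 (u :: real ^ 'n::finite \<Rightarrow> complex) = u"
proof -
  have "foldr (\<lambda>j. D1 j ((0 :: nat ^ 'n) $ j)) js u = u" for js
    by (induction js) auto
  then show ?thesis by (simp add: D_def)
qed

lemma D_axis: "D (axis j N) u = D1 j N u"
proof -
  have "foldr (\<lambda>i. D1 i (axis j N $ i)) js u = (if j \<in> set js then D1 j N u else u)"
    if "distinct js" for js
    using that by (induction js) (auto simp: axis_def)
  from this[OF distinct_coords] show ?thesis by (simp add: D_def set_coords)
qed

lemma norm_prod_list_ge:
  fixes f :: "'a \<Rightarrow> 'b::real_normed_field"
  assumes "0 \<le> c" "\<And>x. x \<in> set xs \<Longrightarrow> c \<le> norm (f x)"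
  shows "c ^ length xs \<le> norm (\<Prod>x\<leftarrow>xs. f x)"
  using assms(2) by (induction xs) (auto simp: norm_mult intro!: mult_mono zero_le_power assms(1))

lemma lnorm_le_max:
  obtains j where "lnorm (\<xi> :: int ^ 'n::finite) \<le> real CARD('n) * \<bar>\<xi> $ j\<bar>"
proof -
  obtain j where j: "\<And>i. \<bar>\<xi> $ i\<bar> \<le> \<bar>\<xi> $ j\<bar>"
    using Max_in[of "range (\<lambda>i. \<bar>\<xi> $ i\<bar>)"] Max_ge[of "range (\<lambda>i. \<bar>\<xi> $ i\<bar>)"] by fastforce
  have "lnorm \<xi> \<le> (\<Sum>i\<in>UNIV. \<bar>rvec \<xi> $ i\<bar>)" by (rule norm_le_l1_cart)
  also have "\<dots> \<le> (\<Sum>i\<in>(UNIV :: 'n set). of_int \<bar>\<xi> $ j\<bar>)"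
    by (rule sum_mono) (use j in \<open>simp add: rvec_def flip: of_int_abs\<close>)
  finally show ?thesis by (intro that[of j]) simp
qed

text \<open>In the direction of the largest coordinate of \<xi>, every factor of the multiplier of
  \<open>D (axis j N)\<close> has size comparable to |\<xi>|, provided \<xi> is not small.\<close>

lemma fcoeff_decay:
  fixes u :: "real ^ 'n::finite \<Rightarrow> complex"
  assumes u: "smooth u" "periodic u" and N: "N > 0"
    and B0: "\<And>x. cmod (u x) \<le> B" and B: "\<And>j x. cmod (D (axis j N) u x) \<le> B"
  shows "cmod (fcoeff u \<xi>) * (1 + lnorm \<xi>) ^ N
      \<le> ((1 + 2 * real CARD('n) * real N) ^ N + (4 * real CARD('n)) ^ N) * B"
proof -
  have n: "1 \<le> real CARD('n)" by (simp add: Suc_leI)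
  have B_nonneg: "0 \<le> B" using B0[of 0] norm_ge_zero order_trans by blast
  obtain j where j: "lnorm \<xi> \<le> real CARD('n) * \<bar>\<xi> $ j\<bar>" by (rule lnorm_le_max)
  define M where "M = real_of_int \<bar>\<xi> $ j\<bar>"
  have M: "lnorm \<xi> \<le> real CARD('n) * M" "0 \<le> M" using j by (auto simp: M_def)
  show ?thesis
  \<comment> \<open>The multiplier vanishes when coordinate j of \<xi> is one of -N, ..., 0. Beyond
    2N each of its factors is at least M / 2; below that threshold \<xi> stays in a bounded set and
    the trivial bound suffices.\<close>
  proof (cases "M \<le> 2 * real N")
    case True
    have "1 + lnorm \<xi> \<le> 1 + 2 * real CARD('n) * real N"
      using M(1) mult_left_mono[OF True, of "real CARD('n)"] by linarith
    then have "(1 + lnorm \<xi>) ^ N \<le> (1 + 2 * real CARD('n) * real N) ^ N"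
      by (intro power_mono) auto
    moreover have "cmod (fcoeff u \<xi>) \<le> B"
      by (intro fcoeff_bound smooth_imp_continuous u B0)
    ultimately have "cmod (fcoeff u \<xi>) * (1 + lnorm \<xi>) ^ N \<le> B * (1 + 2 * real CARD('n) * real N) ^ N"
      by (intro mult_mono B_nonneg) auto
    also have "\<dots> \<le> B * ((1 + 2 * real CARD('n) * real N) ^ N + (4 * real CARD('n)) ^ N)"
      by (intro mult_left_mono B_nonneg) auto
    finally show ?thesis by (simp only: mult.commute)
  next
    case False
    then have M1: "1 \<le> M" "2 * real N \<le> M" using N by auto
    note foldr = fcoeff_foldr_shifted_D[OF u, of j "[0..<Suc N]" \<xi>]
    have "(M / 2) ^ length [0..<Suc N]
        \<le> cmod (\<Prod>r\<leftarrow>[0..<Suc N]. - of_int (\<xi> $ j) - of_nat r)"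
    proof (rule norm_prod_list_ge)
      fix r assume "r \<in> set [0..<Suc N]"
      then have "real r \<le> M / 2" using M1 by auto
      moreover have "cmod (of_int (\<xi> $ j)) \<le> cmod (- of_int (\<xi> $ j) - of_nat r) + cmod (of_nat r)"
        using norm_triangle_ineq4[of "- of_int (\<xi> $ j) - of_nat r" "- of_nat r :: complex"] by simp
      moreover have "cmod (of_int (\<xi> $ j)) = M" by (simp add: M_def)
      ultimately show "M / 2 \<le> cmod (- of_int (\<xi> $ j) - of_nat r)" by simp
    qed (use M in simp)
    from mult_right_mono[OF this norm_ge_zero]
    have "(M / 2) ^ Suc N * cmod (fcoeff u \<xi>) \<le> cmod (fcoeff (D (axis j N) u) \<xi>)"
      using foldr N unfolding D_axis D1_def by (simp add: norm_mult del: upt_Suc power_Suc)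
    also have "\<dots> \<le> B"
      using foldr N B[of j] unfolding D_axis D1_def
      by (intro fcoeff_bound) (auto intro: smooth_imp_continuous simp del: upt_Suc)
    finally have *: "(M / 2) ^ Suc N * cmod (fcoeff u \<xi>) \<le> B" .
    \<comment> \<open>\<open>D1 j N\<close> has N + 1 factors, one more than the decay claimed; the
      surplus factor M / 2 is at least 1.\<close>
    have "1 * (M / 2) ^ N \<le> M / 2 * (M / 2) ^ N"
      using M1 N by (intro mult_right_mono) auto
    then have "(M / 2) ^ N * cmod (fcoeff u \<xi>) \<le> (M / 2) ^ Suc N * cmod (fcoeff u \<xi>)"
      by (intro mult_right_mono) auto
    with * have **: "(M / 2) ^ N * cmod (fcoeff u \<xi>) \<le> B" by simp
    have "1 * 1 \<le> real CARD('n) * M" using n M1 by (intro mult_mono) auto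
    then have "1 + lnorm \<xi> \<le> 4 * real CARD('n) * (M / 2)" using M(1) by linarith
    then have "(1 + lnorm \<xi>) ^ N \<le> (4 * real CARD('n)) ^ N * (M / 2) ^ N"
      unfolding power_mult_distrib[symmetric] by (intro power_mono) auto
    then have "cmod (fcoeff u \<xi>) * (1 + lnorm \<xi>) ^ N
        \<le> cmod (fcoeff u \<xi>) * ((4 * real CARD('n)) ^ N * (M / 2) ^ N)"
      by (intro mult_left_mono) auto
    also have "\<dots> = (4 * real CARD('n)) ^ N * ((M / 2) ^ N * cmod (fcoeff u \<xi>))"
      by (simp only: mult_ac)
    also have "\<dots> \<le> (4 * real CARD('n)) ^ N * B"
      by (intro mult_left_mono **) auto
    also have "\<dots> \<le> ((1 + 2 * real CARD('n) * real N) ^ N + (4 * real CARD('n)) ^ N) * B"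
      by (intro mult_right_mono B_nonneg) auto
    finally show ?thesis .
  qed
qed

section \<open>Differences of the symbol in the lattice variable\<close>

lemma diff_op_commute: "diff_op i (diff_op j \<tau>) = diff_op j (diff_op i \<tau>)"
  by (auto simp: diff_op_def algebra_simps)

lemma Diff_0: "Diff 0 (\<tau> :: int ^ 'n::finite \<Rightarrow> complex) = \<tau>"
proof -
  have "foldr (\<lambda>j. diff_op j ^^ ((0 :: nat ^ 'n) $ j)) js \<tau> = \<tau>" for js
    by (induction js) auto
  then show ?thesis by (simp add: Diff_def)
qed

text \<open>The order of composition fixed by \<open>coords\<close> is unknown, so distinct
  coordinates rely on the commutation of differences; equal coordinates produce a single second
  iterate.\<close>

lemma Diff_axis_axis: "Diff (axis i 1 + axis j 1) \<tau> = diff_op i (diff_op j \<tau>)"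
proof (cases "i = j")
  case True
  have "foldr (\<lambda>l. diff_op l ^^ ((axis i 1 + axis i 1 :: nat ^ 'a) $ l)) js \<tau>
      = (if i \<in> set js then diff_op i (diff_op i \<tau>) else \<tau>)" if "distinct js" for js
    using that by (induction js) (auto simp: axis_def numeral_2_eq_2)
  from this[OF distinct_coords] True show ?thesis by (simp add: Diff_def set_coords)
next
  case False
  have "foldr (\<lambda>l. diff_op l ^^ ((axis i 1 + axis j 1 :: nat ^ 'a) $ l)) js \<tau>
      = (if i \<in> set js then diff_op i else id) ((if j \<in> set js then diff_op j else id) \<tau>)"
    if "distinct js" for js
    using that False by (induction js) (auto simp: axis_def diff_op_commute[of j i])
  from this[OF distinct_coords] show ?thesis by (simp add: Diff_def set_coords)
qed

lemma mi_order_axis_axis: "mi_order (axis i 1 + axis j 1) = 2"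
  by (simp add: mi_order_def axis_def sum.distrib)

text \<open>Differences act on k and the coefficient integrates over x, so linearity interchanges
  them. Smoothness is carried through the induction because linearity of the integral is applied to
  continuous functions.\<close>

lemma smooth_periodic_diff_ops:
  assumes "\<And>k. smooth (\<sigma> k) \<and> periodic (\<sigma> k)"
  shows "smooth (\<lambda>y. foldr diff_op js (\<lambda>l. \<sigma> l y) k) \<and> periodic (\<lambda>y. foldr diff_op js (\<lambda>l. \<sigma> l y) k)
    \<and> foldr diff_op js (\<lambda>p. fcoeff (\<sigma> p) \<xi>) k = fcoeff (\<lambda>y. foldr diff_op js (\<lambda>l. \<sigma> l y) k) \<xi>"
proof (induction js arbitrary: k)
  case (Cons j js)
  let ?u = "\<lambda>k y. foldr diff_op js (\<lambda>l. \<sigma> l y) k"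
  have eq: "(\<lambda>y. foldr diff_op (j # js) (\<lambda>l. \<sigma> l y) k)
      = (\<lambda>y. 1 * ?u (k + axis j 1) y + (-1) * ?u k y)"
    by (simp add: diff_op_def)
  have "smooth (?u k)" "smooth (?u (k + axis j 1))" using Cons.IH by auto
  moreover have "periodic (\<lambda>y. 1 * ?u (k + axis j 1) y + (-1) * ?u k y)"
    using Cons.IH unfolding periodic_def by metis
  moreover have "foldr diff_op (j # js) (\<lambda>p. fcoeff (\<sigma> p) \<xi>) k
      = 1 * fcoeff (?u (k + axis j 1)) \<xi> + (-1) * fcoeff (?u k) \<xi>"
    using Cons.IH[of k] Cons.IH[of "k + axis j 1"] by (simp add: diff_op_def[of j])
  ultimately show ?case
    unfolding eq
    by (intro conjI smooth_lincomb) (simp_all only: fcoeff_lincomb smooth_imp_continuous)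
qed (use assms in auto)

text \<open>The decay estimate draws on the multi-indices 0 and N times a unit vector. There are
  finitely many, so the sum of their constants serves for all k and \<xi>.\<close>

lemma symbol_class_fcoeff_Diff:
  fixes \<sigma> :: "int ^ 'n::finite \<Rightarrow> real ^ 'n \<Rightarrow> complex"
  assumes \<sigma>: "\<sigma> \<in> symbol_class m" and N: "N > 0"
    and sp: "\<And>k. smooth (\<lambda>y. Diff \<alpha> (\<lambda>l. \<sigma> l y) k)" "\<And>k. periodic (\<lambda>y. Diff \<alpha> (\<lambda>l. \<sigma> l y) k)"
  shows "\<exists>A\<ge>0. \<forall>k \<xi>. cmod (fcoeff (\<lambda>y. Diff \<alpha> (\<lambda>l. \<sigma> l y) k) \<xi>)
    \<le> A * (1 + lnorm k) powr (m - real (mi_order \<alpha>)) / (1 + lnorm \<xi>) ^ N"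
proof -
  have "\<exists>C>0. \<forall>k x. cmod (D \<beta> (\<lambda>y. Diff \<alpha> (\<lambda>l. \<sigma> l y) k) x)
      \<le> C * (1 + lnorm k) powr (m - real (mi_order \<alpha>))" for \<beta>
    using \<sigma> unfolding symbol_class_def by blast
  then obtain C where C: "\<And>\<beta>. 0 < C \<beta>" "\<And>\<beta> k x. cmod (D \<beta> (\<lambda>y. Diff \<alpha> (\<lambda>l. \<sigma> l y) k) x)
      \<le> C \<beta> * (1 + lnorm k) powr (m - real (mi_order \<alpha>))"
    by metis
  define C' where "C' = C 0 + (\<Sum>j\<in>UNIV. C (axis j N))"
  have "0 \<le> (\<Sum>j\<in>UNIV. C (axis j N))" "C (axis j N) \<le> (\<Sum>j\<in>UNIV. C (axis j N))" for j
    using C(1) by (auto intro!: sum_nonneg member_le_sum simp: less_imp_le)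
  then have C': "C 0 \<le> C'" "C (axis j N) \<le> C'" for j
    using C(1)[of 0] by (auto simp: C'_def intro: add_increasing add_increasing2)
  define E where "E = (1 + 2 * real CARD('n) * real N) ^ N + (4 * real CARD('n)) ^ N"
  have "0 \<le> E" by (simp add: E_def)
  moreover have "0 \<le> C'" using C' C(1)[of 0] by linarith
  moreover have "cmod (fcoeff (\<lambda>y. Diff \<alpha> (\<lambda>l. \<sigma> l y) k) \<xi>)
    \<le> E * C' * (1 + lnorm k) powr (m - real (mi_order \<alpha>)) / (1 + lnorm \<xi>) ^ N" for k \<xi>
  proof -
    have *: "cmod (D \<beta> (\<lambda>y. Diff \<alpha> (\<lambda>l. \<sigma> l y) k) x) \<le> C' * (1 + lnorm k) powr (m - real (mi_order \<alpha>))"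
      if "C \<beta> \<le> C'" for \<beta> x
      using C(2)[of \<beta> k x] mult_right_mono[OF that powr_ge_zero] by (rule order_trans)
    have "cmod (fcoeff (\<lambda>y. Diff \<alpha> (\<lambda>l. \<sigma> l y) k) \<xi>) * (1 + lnorm \<xi>) ^ N
        \<le> E * (C' * (1 + lnorm k) powr (m - real (mi_order \<alpha>)))"
      unfolding E_def
      by (rule fcoeff_decay[OF sp N]) (rule *[of 0, unfolded D_0, OF C'(1)], rule *[OF C'(2)])
    moreover have "0 < (1 + lnorm \<xi>) ^ N" by (intro zero_less_power add_pos_nonneg) auto
    ultimately show ?thesis by (simp add: pos_le_divide_eq mult_ac)
  qed
  ultimately show ?thesis by (intro exI[of _ "E * C'"]) auto
qed

text \<open>The two orders recorded match the error terms to come: order 0 is paired with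
  differences of windows and of cutoffs, order 2 with averages over even weights.\<close>

lemma symbol_class_fcoeff:
  fixes \<sigma> :: "int ^ 'n::finite \<Rightarrow> real ^ 'n \<Rightarrow> complex"
  assumes \<sigma>: "\<sigma> \<in> symbol_class m" and N: "N > 0"
  obtains A where "A \<ge> 0"
    "\<And>k \<xi>. cmod (fcoeff (\<sigma> k) \<xi>) \<le> A * (1 + lnorm k) powr m / (1 + lnorm \<xi>) ^ N"
    "\<And>i j k \<xi>. cmod (diff_op i (diff_op j (\<lambda>p. fcoeff (\<sigma> p) \<xi>)) k)
       \<le> A * (1 + lnorm k) powr (m - 2) / (1 + lnorm \<xi>) ^ N"
proof -
  have sp: "smooth (\<sigma> k) \<and> periodic (\<sigma> k)" for k
    using \<sigma> unfolding symbol_class_def by blast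
  have "\<exists>A\<ge>0. \<forall>k \<xi>. cmod (fcoeff (\<lambda>y. Diff 0 (\<lambda>l. \<sigma> l y) k) \<xi>)
      \<le> A * (1 + lnorm k) powr (m - real (mi_order (0 :: nat ^ 'n))) / (1 + lnorm \<xi>) ^ N"
    by (rule symbol_class_fcoeff_Diff[OF \<sigma> N]) (use sp in \<open>simp_all add: Diff_0\<close>)
  then obtain A where A: "0 \<le> A"
      "\<And>k \<xi>. cmod (fcoeff (\<sigma> k) \<xi>) \<le> A * (1 + lnorm k) powr m / (1 + lnorm \<xi>) ^ N"
    by (auto simp: Diff_0 mi_order_def)
  have "\<exists>A\<ge>0. \<forall>k \<xi>. cmod (diff_op i (diff_op j (\<lambda>p. fcoeff (\<sigma> p) \<xi>)) k)
      \<le> A * (1 + lnorm k) powr (m - 2) / (1 + lnorm \<xi>) ^ N" for i j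
  proof -
    note * = smooth_periodic_diff_ops[of \<sigma> "[i, j]", OF sp, simplified]
    have "smooth (\<lambda>y. Diff (axis i 1 + axis j 1) (\<lambda>l. \<sigma> l y) k)"
      "periodic (\<lambda>y. Diff (axis i 1 + axis j 1) (\<lambda>l. \<sigma> l y) k)" for k
      unfolding Diff_axis_axis using * by blast+
    from symbol_class_fcoeff_Diff[OF \<sigma> N this] show ?thesis
      unfolding Diff_axis_axis mi_order_axis_axis using * by (simp del: ex_simps)
  qed
  then obtain A' where A': "\<And>i j. 0 \<le> A' i j"
      "\<And>i j k \<xi>. cmod (diff_op i (diff_op j (\<lambda>p. fcoeff (\<sigma> p) \<xi>)) k)
        \<le> A' i j * (1 + lnorm k) powr (m - 2) / (1 + lnorm \<xi>) ^ N"
    by metis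
  define S where "S = (\<Sum>(i, j)\<in>UNIV. A' i j)"
  have le: "A' i j \<le> S" for i j
    unfolding S_def using member_le_sum[of "(i, j)" UNIV "\<lambda>(i, j). A' i j"] A'(1) by auto
  have S: "0 \<le> S" unfolding S_def by (auto intro!: sum_nonneg A'(1))
  show ?thesis
  proof (rule that[of "A + S"])
    fix k \<xi> :: "int ^ 'n" and i j :: 'n
    have mono: "c * (1 + lnorm k) powr s / (1 + lnorm \<xi>) ^ N
        \<le> (A + S) * (1 + lnorm k) powr s / (1 + lnorm \<xi>) ^ N" if "c \<le> A + S" for c s
      using that by (intro divide_right_mono mult_right_mono) auto
    show "cmod (fcoeff (\<sigma> k) \<xi>) \<le> (A + S) * (1 + lnorm k) powr m / (1 + lnorm \<xi>) ^ N"
      using A(2)[of k \<xi>] mono[of A m] S by linarith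
    show "cmod (diff_op i (diff_op j (\<lambda>p. fcoeff (\<sigma> p) \<xi>)) k)
        \<le> (A + S) * (1 + lnorm k) powr (m - 2) / (1 + lnorm \<xi>) ^ N"
      using A'(2)[of i j \<xi> k] mono[of "A' i j" "m - 2"] le[of i j] A(1) by linarith
  qed (use A(1) S in simp)
qed

subsection \<open>Weights and counting on the lattice\<close>

lemma rvec_diff: "rvec (k - l) = rvec k - rvec l"
  and rvec_minus: "rvec (- k) = - rvec k"
  and rvec_0 [simp]: "rvec 0 = 0"
  by (auto simp: rvec_def vec_eq_iff)

lemma lnorm_minus [simp]: "lnorm (- k) = lnorm k"
  by (simp add: rvec_minus)

lemma lnorm_minus_commute: "lnorm (k - l) = lnorm (l - k)"
  by (simp add: rvec_diff norm_minus_commute)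

definition bracket :: "int ^ 'n::finite \<Rightarrow> real" where
  "bracket k = 1 + lnorm k"

lemma bracket_ge_1 [simp]: "1 \<le> bracket k"
  and bracket_pos [simp]: "0 < bracket k"
  and bracket_nonneg [simp]: "0 \<le> bracket k"
  and bracket_nz [simp]: "bracket k \<noteq> 0"
  using norm_ge_zero[of "rvec k"] unfolding bracket_def by linarith+

lemma bracket_minus_commute: "bracket (k - l) = bracket (l - k)"
  by (simp add: bracket_def lnorm_minus_commute)

lemma bracket_le_mult: "bracket p \<le> bracket k * bracket (p - k)"
proof -
  have "lnorm p \<le> lnorm k + lnorm (p - k)"
    using norm_triangle_ineq[of "rvec k" "rvec (p - k)"] by (simp add: rvec_diff)
  moreover have "0 \<le> lnorm k * lnorm (p - k)" by simp
  ultimately show ?thesis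
    unfolding bracket_def distrib_left distrib_right mult_1 mult_1_right by linarith
qed

text \<open>The comparison of x and y is two-sided because the exponent may have either sign, and a
  negative one exchanges their roles.\<close>

lemma powr_le_of_ratio:
  fixes x y c :: real
  assumes "0 < x" "0 < y" "1 \<le> c" "x \<le> c * y" "y \<le> c * x"
  shows "x powr s \<le> c powr \<bar>s\<bar> * y powr s"
proof (cases "0 \<le> s")
  case True
  have "x powr s \<le> (c * y) powr s" using True assms by (intro powr_mono2) auto
  then show ?thesis using True assms by (simp add: powr_mult)
next
  case False
  have "(c * x) powr s \<le> y powr s" using False assms by (intro powr_mono2') auto
  then have "c powr \<bar>s\<bar> * (c powr s * x powr s) \<le> c powr \<bar>s\<bar> * y powr s"
    using assms by (intro mult_left_mono) (auto simp: powr_mult)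
  moreover have "c powr \<bar>s\<bar> * c powr s = 1"
    using False assms by (simp flip: powr_add)
  ultimately show ?thesis by (simp flip: mult.assoc)
qed

text \<open>Peetre's inequality, with the off-diagonal exponent rounded up to an integer so that the
  loss can be cancelled against the decay \<open>bracket \<xi> ^ N\<close>.\<close>

lemma peetre:
  assumes "\<bar>s\<bar> \<le> real K"
  shows "bracket p powr s \<le> bracket (p - k) ^ K * bracket k powr s"
proof -
  have "bracket p powr s \<le> bracket (p - k) powr \<bar>s\<bar> * bracket k powr s"
    using bracket_le_mult[of p k] bracket_le_mult[of k p] bracket_minus_commute[of k p]
    by (intro powr_le_of_ratio) (auto simp: mult.commute)
  also have "\<dots> \<le> bracket (p - k) powr real K * bracket k powr s"
    using assms by (intro mult_right_mono powr_mono) auto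
  finally show ?thesis by (simp add: powr_realpow)
qed

lemma bracket_near:
  assumes "lnorm (q - k) \<le> bracket k / 2"
  shows "bracket q powr s \<le> 2 powr \<bar>s\<bar> * bracket k powr s"
proof (rule powr_le_of_ratio)
  show "bracket q \<le> 2 * bracket k"
    using norm_triangle_ineq[of "rvec k" "rvec (q - k)"] assms norm_ge_zero[of "rvec k"]
    unfolding rvec_diff bracket_def by (simp del: norm_ge_zero)
  show "bracket k \<le> 2 * bracket q"
    using norm_triangle_ineq[of "rvec q" "rvec (k - q)"] assms norm_ge_zero[of "rvec q"]
      norm_minus_commute[of "rvec k" "rvec q"]
    unfolding rvec_diff bracket_def by (simp del: norm_ge_zero)
qed auto

section \<open>Lattice points in boxes and balls, and summability of the weights\<close>

lemma finite_vec_box: "finite T \<Longrightarrow> finite {v :: 'a ^ 'n::finite. \<forall>j. v $ j \<in> T}"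
  and sum_prod_vec_box: "finite T \<Longrightarrow>
    (\<Sum>v\<in>{v :: 'a ^ 'n::finite. \<forall>j. v $ j \<in> T}. \<Prod>j\<in>UNIV. b (v $ j))
      = (\<Sum>i\<in>T. b i :: real) ^ CARD('n)"
proof -
  assume T: "finite T"
  have bij: "bij_betw vec_lambda (PiE (UNIV :: 'n set) (\<lambda>_. T)) {v :: 'a ^ 'n. \<forall>j. v $ j \<in> T}"
    by (rule bij_betwI[where g = vec_nth]) auto
  show "finite {v :: 'a ^ 'n::finite. \<forall>j. v $ j \<in> T}"
    using bij_betw_finite[OF bij] T by (simp add: finite_PiE)
  show "(\<Sum>v\<in>{v :: 'a ^ 'n::finite. \<forall>j. v $ j \<in> T}. \<Prod>j\<in>UNIV. b (v $ j))
      = (\<Sum>i\<in>T. b i) ^ CARD('n)"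
    using T prod_sum_PiE[of UNIV "\<lambda>_ :: 'n. T" "\<lambda>_. b"]
    by (subst sum.reindex_bij_betw[OF bij, symmetric]) simp
qed

lemma card_vec_box:
  "finite T \<Longrightarrow> real (card {v :: 'a ^ 'n::finite. \<forall>j. v $ j \<in> T}) = real (card T) ^ CARD('n)"
  using sum_prod_vec_box[of T "\<lambda>_. 1", where 'n = 'n] by simp

lemma component_le_lnorm: "\<bar>real_of_int (h $ j)\<bar> \<le> lnorm h"
  using component_le_norm_cart[of "rvec h" j] by (simp add: rvec_def)

lemma lnorm_le_sum: "lnorm h \<le> (\<Sum>j\<in>UNIV. \<bar>real_of_int (h $ j)\<bar>)"
  using norm_le_l1_cart[of "rvec h"] by (simp add: rvec_def)

text \<open>The ball lies in the cube of half-side r and contains the cube of half-side r / n, since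
  the norm is at least each coordinate and at most the sum of all n, in absolute value.\<close>

lemma finite_lnorm_ball [simp]: "finite {h :: int ^ 'n::finite. lnorm h \<le> r}"
  and card_lnorm_ball_le: "0 \<le> r \<Longrightarrow> real (card {h :: int ^ 'n. lnorm h \<le> r}) \<le> (2 * r + 1) ^ CARD('n)"
  and card_lnorm_ball_ge: "0 \<le> r \<Longrightarrow> (r / CARD('n)) ^ CARD('n) \<le> real (card {h :: int ^ 'n. lnorm h \<le> r})"
proof -
  have sub: "{h :: int ^ 'n. lnorm h \<le> r} \<subseteq> {h. \<forall>j. h $ j \<in> {- \<lfloor>r\<rfloor>..\<lfloor>r\<rfloor>}}"
  proof safe
    fix h :: "int ^ 'n" and j assume "lnorm h \<le> r"
    then have "\<bar>real_of_int (h $ j)\<bar> \<le> r" using component_le_lnorm order_trans by blast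
    then have "\<bar>h $ j\<bar> \<le> \<lfloor>r\<rfloor>" by (simp add: le_floor_iff)
    then show "h $ j \<in> {- \<lfloor>r\<rfloor>..\<lfloor>r\<rfloor>}" by auto
  qed
  have fin: "finite {h :: int ^ 'n. \<forall>j. h $ j \<in> {- \<lfloor>r\<rfloor>..\<lfloor>r\<rfloor>}}" for r :: real
    by (rule finite_vec_box) simp
  show finr: "finite {h :: int ^ 'n. lnorm h \<le> r}"
    by (rule finite_subset[OF sub fin])
  assume r: "0 \<le> r"
  have "real (card {h :: int ^ 'n. lnorm h \<le> r}) \<le> real (card {h :: int ^ 'n. \<forall>j. h $ j \<in> {- \<lfloor>r\<rfloor>..\<lfloor>r\<rfloor>}})"
    using card_mono[OF fin sub] by simp
  also have "\<dots> = real (nat (2 * \<lfloor>r\<rfloor> + 1)) ^ CARD('n)"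
    by (subst card_vec_box) simp_all
  also have "\<dots> \<le> (2 * r + 1) ^ CARD('n)"
    by (rule power_mono) (use r in \<open>simp_all add: of_nat_nat\<close>)
  finally show "real (card {h :: int ^ 'n. lnorm h \<le> r}) \<le> (2 * r + 1) ^ CARD('n)" .
  define s where "s = r / CARD('n)"
  have s: "0 \<le> s" using r by (simp add: s_def)
  have sub': "{h :: int ^ 'n. \<forall>j. h $ j \<in> {- \<lfloor>s\<rfloor>..\<lfloor>s\<rfloor>}} \<subseteq> {h. lnorm h \<le> r}"
  proof safe
    fix h :: "int ^ 'n" assume h: "\<forall>j. h $ j \<in> {- \<lfloor>s\<rfloor>..\<lfloor>s\<rfloor>}"
    have "\<bar>real_of_int (h $ j)\<bar> \<le> s" for j
    proof -
      have "\<bar>h $ j\<bar> \<le> \<lfloor>s\<rfloor>" using h[rule_format, of j] by auto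
      then show ?thesis by (simp add: le_floor_iff)
    qed
    then have "(\<Sum>j\<in>UNIV. \<bar>real_of_int (h $ j)\<bar>) \<le> (\<Sum>j\<in>(UNIV :: 'n set). s)"
      by (intro sum_mono)
    then show "lnorm h \<le> r" using lnorm_le_sum[of h] by (simp add: s_def)
  qed
  have "s ^ CARD('n) \<le> real (nat (2 * \<lfloor>s\<rfloor> + 1)) ^ CARD('n)"
  proof (rule power_mono)
    have "s \<le> of_int \<lfloor>s\<rfloor> + 1" "0 \<le> real_of_int \<lfloor>s\<rfloor>" using s by (linarith, simp)
    then have "s \<le> 2 * real_of_int \<lfloor>s\<rfloor> + 1" by linarith
    then show "s \<le> real (nat (2 * \<lfloor>s\<rfloor> + 1))" using s by (simp add: of_nat_nat)
  qed (use s in simp)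
  also have "\<dots> = real (card {h :: int ^ 'n. \<forall>j. h $ j \<in> {- \<lfloor>s\<rfloor>..\<lfloor>s\<rfloor>}})"
    by (subst card_vec_box) simp_all
  also have "\<dots> \<le> real (card {h :: int ^ 'n. lnorm h \<le> r})"
    using card_mono[OF finr sub'] by simp
  finally show "(r / CARD('n)) ^ CARD('n) \<le> real (card {h :: int ^ 'n. lnorm h \<le> r})"
    by (simp add: s_def)
qed

lemma sum_inverse_square_int_bounded:
  obtains C :: real where "\<And>M. (\<Sum>i\<in>{- int M..int M}. 1 / (1 + \<bar>real_of_int i\<bar>)\<^sup>2) \<le> C"
proof -
  have sm: "summable (\<lambda>n. 1 / (1 + real n)\<^sup>2)"
    using inverse_squares_sums sums_summable by (force simp: add.commute)
  define C where "C = (\<Sum>n. 1 / (1 + real n)\<^sup>2)"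
  have "(\<Sum>i\<in>{- int M..int M}. 1 / (1 + \<bar>real_of_int i\<bar>)\<^sup>2) \<le> C + C" for M
  proof -
    have half: "(\<Sum>i\<in>f ` {..M}. 1 / (1 + \<bar>real_of_int i\<bar>)\<^sup>2) \<le> C"
      if "inj f" "\<And>n. \<bar>real_of_int (f n)\<bar> = real n" for f :: "nat \<Rightarrow> int"
    proof -
      have "(\<Sum>i\<in>f ` {..M}. 1 / (1 + \<bar>real_of_int i\<bar>)\<^sup>2) = (\<Sum>n\<le>M. 1 / (1 + real n)\<^sup>2)"
        using that by (subst sum.reindex) (auto simp: inj_on_def)
      also have "\<dots> \<le> C" unfolding C_def by (rule sum_le_suminf[OF sm]) auto
      finally show ?thesis .
    qed
    have sub: "{- int M..int M} \<subseteq> int ` {..M} \<union> (\<lambda>n. - int n) ` {..M}"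
    proof
      fix i assume i: "i \<in> {- int M..int M}"
      show "i \<in> int ` {..M} \<union> (\<lambda>n. - int n) ` {..M}"
      proof (cases "0 \<le> i")
        case True
        then have "i = int (nat i)" "nat i \<le> M" using i by auto
        then show ?thesis by blast
      next
        case False
        then have "i = - int (nat (- i))" "nat (- i) \<le> M" using i by auto
        then show ?thesis by blast
      qed
    qed
    have "(\<Sum>i\<in>{- int M..int M}. 1 / (1 + \<bar>real_of_int i\<bar>)\<^sup>2)
        \<le> (\<Sum>i\<in>int ` {..M} \<union> (\<lambda>n. - int n) ` {..M}. 1 / (1 + \<bar>real_of_int i\<bar>)\<^sup>2)"
      by (rule sum_mono2[OF _ sub]) auto
    also have "\<dots> \<le> (\<Sum>i\<in>int ` {..M}. 1 / (1 + \<bar>real_of_int i\<bar>)\<^sup>2)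
        + (\<Sum>i\<in>(\<lambda>n. - int n) ` {..M}. 1 / (1 + \<bar>real_of_int i\<bar>)\<^sup>2)"
      by (subst sum_Un) (auto intro!: sum_nonneg)
    also have "\<dots> \<le> C + C" by (intro add_mono half) (auto simp: inj_on_def)
    finally show ?thesis .
  qed
  then show ?thesis by (rule that)
qed

text \<open>The exponent 2n provides one inverse square for each coordinate, and
  \<open>bracket h\<close> dominates 1 plus the absolute value of each coordinate, so the n-th power
  of a one-dimensional sum is a bound. Uniformity over finite sets is the form used in Schur's
  test.\<close>

lemma sum_bracket_bounded:
  obtains C :: real where "0 \<le> C"
    "\<And>S :: (int ^ 'n::finite) set. finite S \<Longrightarrow> (\<Sum>h\<in>S. 1 / bracket h ^ (2 * CARD('n))) \<le> C"
proof -
  obtain C :: real where C: "\<And>M. (\<Sum>i\<in>{- int M..int M}. 1 / (1 + \<bar>real_of_int i\<bar>)\<^sup>2) \<le> C"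
    using sum_inverse_square_int_bounded by blast
  have C0: "0 \<le> C" using C[of 0] by simp
  have "(\<Sum>h\<in>S. 1 / bracket h ^ (2 * CARD('n))) \<le> C ^ CARD('n)" if S: "finite S" for S :: "(int ^ 'n) set"
  proof -
    have "\<exists>M. \<forall>h\<in>S. \<forall>j. \<bar>h $ j\<bar> \<le> int M"
      using S
    proof (induction S)
      case (insert h S)
      then obtain M where M: "\<forall>h\<in>S. \<forall>j. \<bar>h $ j\<bar> \<le> int M" by blast
      define K where "K = (\<Sum>j\<in>UNIV. nat \<bar>h $ j\<bar>)"
      have "nat \<bar>h $ j\<bar> \<le> K" for j unfolding K_def by (rule member_le_sum) auto
      then have "\<bar>h $ j\<bar> \<le> int (max M K)" for j by (meson le_max_iff_disj nat_le_iff)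
      moreover have "int M \<le> int (max M K)" by simp
      ultimately have "\<forall>h\<in>insert h S. \<forall>j. \<bar>h $ j\<bar> \<le> int (max M K)"
        using M by (metis insertE order_trans)
      then show ?case by blast
    qed auto
    then obtain M where M: "\<And>h j. h \<in> S \<Longrightarrow> \<bar>h $ j\<bar> \<le> int M" by blast
    let ?B = "{h :: int ^ 'n. \<forall>j. h $ j \<in> {- int M..int M}}"
    have sub: "S \<subseteq> ?B" using M by (auto simp: abs_le_iff minus_le_iff)
    have fin: "finite ?B" by (rule finite_vec_box) simp
    have "(\<Sum>h\<in>S. 1 / bracket h ^ (2 * CARD('n))) \<le> (\<Sum>h\<in>S. \<Prod>j\<in>UNIV. 1 / (1 + \<bar>real_of_int (h $ j)\<bar>)\<^sup>2)"
    proof (rule sum_mono)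
      fix h :: "int ^ 'n"
      have "(\<Prod>j\<in>(UNIV :: 'n set). 1 / (bracket h)\<^sup>2) \<le> (\<Prod>j\<in>UNIV. 1 / (1 + \<bar>real_of_int (h $ j)\<bar>)\<^sup>2)"
        by (intro prod_mono conjI divide_left_mono power_mono mult_pos_pos zero_less_power)
           (auto simp: bracket_def component_le_lnorm add_pos_nonneg)
      then show "1 / bracket h ^ (2 * CARD('n)) \<le> (\<Prod>j\<in>UNIV. 1 / (1 + \<bar>real_of_int (h $ j)\<bar>)\<^sup>2)"
        by (simp add: power_mult power_one_over)
    qed
    also have "\<dots> \<le> (\<Sum>h\<in>?B. \<Prod>j\<in>UNIV. 1 / (1 + \<bar>real_of_int (h $ j)\<bar>)\<^sup>2)"
      by (rule sum_mono2[OF fin sub]) (auto intro!: prod_nonneg)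
    also have "\<dots> = (\<Sum>i\<in>{- int M..int M}. 1 / (1 + \<bar>real_of_int i\<bar>)\<^sup>2) ^ CARD('n)"
      by (rule sum_prod_vec_box) simp
    also have "\<dots> \<le> C ^ CARD('n)" by (intro power_mono C sum_nonneg) auto
    finally show ?thesis .
  qed
  with C0 show ?thesis by (intro that[of "C ^ CARD('n)"]) auto
qed

subsection \<open>Taylor estimates for finite differences\<close>

lemma lnorm_mono:
  assumes "\<And>j. \<bar>h $ j\<bar> \<le> \<bar>h' $ j\<bar>"
  shows "lnorm h \<le> lnorm h'"
  using assms by (intro norm_le_componentwise_cart) (simp add: rvec_def flip: of_int_abs)

text \<open>A path of unit steps joins k to k + h, and the induction removes one step at a time by
  pulling a coordinate of h towards zero. The path stays in the ball because shrinking coordinates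
  does not increase the norm.\<close>

lemma diff_le_sum_abs:
  fixes b :: "int ^ 'n::finite \<Rightarrow> complex"
  assumes "\<And>i q. lnorm (q - k) \<le> \<rho> \<Longrightarrow> cmod (diff_op i b q) \<le> M" and "lnorm h \<le> \<rho>"
  shows "cmod (b (k + h) - b k) \<le> (\<Sum>j\<in>UNIV. \<bar>real_of_int (h $ j)\<bar>) * M"
  using assms(2)
proof (induction "\<Sum>j\<in>UNIV. nat \<bar>h $ j\<bar>" arbitrary: h)
  case 0
  then have "h = 0" by (simp add: vec_eq_iff)
  then show ?case by simp
next
  case (Suc n)
  then obtain j where j: "h $ j \<noteq> 0" by (metis abs_zero nat_0 sum.not_neutral_contains_not_neutral Zero_not_Suc)
  define h' where "h' = h - axis j (sgn (h $ j))"
  have h': "h' $ i = (if i = j then h $ j - sgn (h $ j) else h $ i)" for i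
    by (simp add: h'_def axis_def)
  have le: "\<bar>h' $ i\<bar> \<le> \<bar>h $ i\<bar>" for i using j by (auto simp: h' sgn_if)
  have "(\<Sum>i\<in>UNIV. nat \<bar>h $ i\<bar>) = nat \<bar>h $ j\<bar> + (\<Sum>i\<in>UNIV - {j}. nat \<bar>h $ i\<bar>)"
    "(\<Sum>i\<in>UNIV. nat \<bar>h' $ i\<bar>) = nat \<bar>h' $ j\<bar> + (\<Sum>i\<in>UNIV - {j}. nat \<bar>h' $ i\<bar>)"
    "(\<Sum>i\<in>UNIV. \<bar>real_of_int (h $ i)\<bar>) = \<bar>real_of_int (h $ j)\<bar> + (\<Sum>i\<in>UNIV - {j}. \<bar>real_of_int (h $ i)\<bar>)"
    "(\<Sum>i\<in>UNIV. \<bar>real_of_int (h' $ i)\<bar>) = \<bar>real_of_int (h' $ j)\<bar> + (\<Sum>i\<in>UNIV - {j}. \<bar>real_of_int (h' $ i)\<bar>)"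
    by (simp_all add: sum.remove)
  moreover have "(\<Sum>i\<in>UNIV - {j}. nat \<bar>h' $ i\<bar>) = (\<Sum>i\<in>UNIV - {j}. nat \<bar>h $ i\<bar>)"
    "(\<Sum>i\<in>UNIV - {j}. \<bar>real_of_int (h' $ i)\<bar>) = (\<Sum>i\<in>UNIV - {j}. \<bar>real_of_int (h $ i)\<bar>)"
    by (auto simp: h')
  moreover have "nat \<bar>h $ j\<bar> = Suc (nat \<bar>h' $ j\<bar>)" "\<bar>real_of_int (h $ j)\<bar> = 1 + \<bar>real_of_int (h' $ j)\<bar>"
    using j by (auto simp: h' sgn_if)
  ultimately have n: "n = (\<Sum>j\<in>UNIV. nat \<bar>h' $ j\<bar>)"
    and sum: "(\<Sum>i\<in>UNIV. \<bar>real_of_int (h $ i)\<bar>) = 1 + (\<Sum>i\<in>UNIV. \<bar>real_of_int (h' $ i)\<bar>)"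
    using Suc.hyps(2) by auto
  have h'\<rho>: "lnorm h' \<le> \<rho>" using lnorm_mono[OF le] Suc.prems by (rule order_trans)
  have "cmod (b (k + h) - b (k + h')) \<le> M"
  proof (cases "h $ j > 0")
    case True
    then have eq: "k + h = k + h' + axis j 1" by (simp add: h'_def)
    show ?thesis unfolding eq using assms(1)[of "k + h'" j] h'\<rho> by (simp add: diff_op_def)
  next
    case False
    \<comment> \<open>For a negative coordinate the positive unit step leads from k + h to k + h',
      so the difference is taken at k + h.\<close>
    then have eq: "k + h' = k + h + axis j 1" using j by (simp add: h'_def vec_eq_iff axis_def)
    show ?thesis unfolding eq using assms(1)[of "k + h" j] Suc.prems
      by (simp add: diff_op_def norm_minus_commute)
  qed
  moreover have "cmod (b (k + h') - b k) \<le> (\<Sum>j\<in>UNIV. \<bar>real_of_int (h' $ j)\<bar>) * M"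
    by (rule Suc.hyps(1)[OF n h'\<rho>])
  moreover have "cmod (b (k + h) - b k) \<le> cmod (b (k + h) - b (k + h')) + cmod (b (k + h') - b k)"
    using norm_triangle_ineq[of "b (k + h) - b (k + h')" "b (k + h') - b k"] by simp
  ultimately show ?case unfolding sum by (simp add: algebra_simps)
qed

lemma diff_le_lnorm:
  fixes b :: "int ^ 'n::finite \<Rightarrow> complex"
  assumes b: "\<And>i q. lnorm (q - k) \<le> lnorm h \<Longrightarrow> cmod (diff_op i b q) \<le> M"
  shows "cmod (b (k + h) - b k) \<le> real CARD('n) * lnorm h * M"
proof -
  \<comment> \<open>Any coordinate would do here; the bound is evaluated once to see that M is
    non-negative.\<close>
  have "cmod (diff_op undefined b k) \<le> M" by (rule b) simp
  then have "0 \<le> M" using norm_ge_zero order_trans by blast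
  moreover have "(\<Sum>j\<in>UNIV. \<bar>real_of_int (h $ j)\<bar>) \<le> (\<Sum>j\<in>(UNIV :: 'n set). lnorm h)"
    by (intro sum_mono component_le_lnorm)
  ultimately have "(\<Sum>j\<in>UNIV. \<bar>real_of_int (h $ j)\<bar>) * M \<le> real CARD('n) * lnorm h * M"
    by (intro mult_right_mono) auto
  with diff_le_sum_abs[OF b order_refl] show ?thesis by (rule order_trans)
qed

text \<open>Up to sign, the symmetric second difference is the increment along -h of the first
  difference \<open>b\<close>, so the first-order estimate applies twice. Two displacements of
  length at most |h| account for the radius \<open>2 * lnorm h\<close>.\<close>

lemma second_diff_le:
  fixes a :: "int ^ 'n::finite \<Rightarrow> complex"
  assumes a: "\<And>i j q. lnorm (q - k) \<le> 2 * lnorm h \<Longrightarrow> cmod (diff_op i (diff_op j a) q) \<le> M"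
  shows "cmod (a (k + h) + a (k - h) - 2 * a k) \<le> (real CARD('n))\<^sup>2 * (lnorm h)\<^sup>2 * M"
proof -
  define b where "b = (\<lambda>q. a (q + h) - a q)"
  have "cmod (b (k + (- h)) - b k) \<le> real CARD('n) * lnorm (- h) * (real CARD('n) * lnorm h * M)"
  proof (rule diff_le_lnorm)
    fix i q assume q: "lnorm (q - k) \<le> lnorm (- h)"
    have "cmod (diff_op i a (q + h) - diff_op i a q) \<le> real CARD('n) * lnorm h * M"
    proof (rule diff_le_lnorm)
      fix j q' assume "lnorm (q' - q) \<le> lnorm h"
      then have "lnorm (q' - k) \<le> 2 * lnorm h"
        using norm_triangle_ineq[of "rvec (q' - q)" "rvec (q - k)"] q by (simp add: rvec_diff)
      then show "cmod (diff_op j (diff_op i a) q') \<le> M" by (rule a)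
    qed
    moreover have "diff_op i b q = diff_op i a (q + h) - diff_op i a q"
      by (simp add: b_def diff_op_def algebra_simps)
    ultimately show "cmod (diff_op i b q) \<le> real CARD('n) * lnorm h * M" by simp
  qed
  moreover have "b (k + (- h)) - b k = - (a (k + h) + a (k - h) - 2 * a k)"
    by (simp add: b_def)
  ultimately show ?thesis by (simp add: power2_eq_square mult_ac norm_minus_cancel del: minus_add_distrib minus_diff_eq)
qed

subsection \<open>Friedrichs symmetrization\<close>

text \<open>The factor 1/4 keeps \<open>2 * rad k\<close> below half the weight at k, so every point
  that a second difference within the window touches has weight comparable to that at k.\<close>

definition rad :: "int ^ 'n::finite \<Rightarrow> real" where
  "rad k = sqrt (bracket k) / 4"

definition tent :: "int ^ 'n::finite \<Rightarrow> int ^ 'n \<Rightarrow> real" where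
  "tent p k = max 0 (rad k - lnorm (p - k))"

definition cell :: "int ^ 'n::finite \<Rightarrow> (int ^ 'n) set" where
  "cell k = {p. lnorm (p - k) \<le> rad k}"

definition mass :: "int ^ 'n::finite \<Rightarrow> real" where
  "mass k = (\<Sum>p\<in>cell k. (tent p k)\<^sup>2)"

text \<open>Normalised over p, so that for fixed k the squares are averaging weights on the
  lattice.\<close>

definition window :: "int ^ 'n::finite \<Rightarrow> int ^ 'n \<Rightarrow> real" where
  "window p k = tent p k / sqrt (mass k)"

lemma rad_ge: "1 / 4 \<le> rad k"
  by (simp add: rad_def)

lemma rad_pos [simp]: "0 < rad k"
  using rad_ge[of k] by linarith

lemma rad_nonneg [simp]: "0 \<le> rad k"
  using rad_pos[of k] by linarith

lemma rad_sq: "(rad k)\<^sup>2 = bracket k / 16"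
  by (simp add: rad_def power_divide)

lemma two_rad_le: "2 * rad k \<le> bracket k / 2"
  using bracket_ge_1[of k] real_sqrt_le_mono[of "bracket k" "(bracket k)\<^sup>2"] power_increasing[of 1 2 "bracket k"]
  by (simp add: rad_def)

text \<open>Bounding the square root of \<open>bracket (k - l)\<close> by
  \<open>bracket (k - l)\<close> itself keeps all later losses integer powers.\<close>

lemma rad_le_mult: "rad k \<le> rad l * bracket (k - l)"
proof -
  have "bracket k \<le> bracket l * (bracket (k - l))\<^sup>2"
    using power_increasing[of 1 2 "bracket (k - l)"]
    by (intro order_trans[OF bracket_le_mult[of k l]] mult_left_mono) auto
  then have "sqrt (bracket k) \<le> sqrt (bracket l) * bracket (k - l)"
    using real_sqrt_le_mono by (fastforce simp: real_sqrt_mult)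
  then show ?thesis by (simp add: rad_def)
qed

text \<open>The square root is Lipschitz on weights, which are at least 1. Hence the dependence of
  the radius on the centre does not spoil the Lipschitz bound for tents.\<close>

lemma abs_rad_diff_le: "\<bar>rad k - rad l\<bar> \<le> lnorm (k - l)"
proof -
  have *: "rad k \<le> rad l + lnorm (k - l)" for k l :: "int ^ 'a"
  proof -
    have "bracket k \<le> bracket l + lnorm (k - l)"
      using norm_triangle_ineq[of "rvec l" "rvec (k - l)"] by (simp add: rvec_diff bracket_def)
    also have "\<dots> \<le> (sqrt (bracket l) + lnorm (k - l))\<^sup>2"
    proof -
      have "1 * lnorm (k - l) \<le> 2 * sqrt (bracket l) * lnorm (k - l)"
        using real_sqrt_ge_one[OF bracket_ge_1[of l]] by (intro mult_right_mono) (linarith, simp)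
      then show ?thesis by (simp add: power2_sum add_increasing)
    qed
    finally have "sqrt (bracket k) \<le> sqrt (bracket l) + lnorm (k - l)"
      by (intro real_le_lsqrt) auto
    then show ?thesis using norm_ge_zero[of "rvec (k - l)"] unfolding rad_def by linarith
  qed
  show ?thesis using *[of k l] *[of l k] lnorm_minus_commute[of k l] by linarith
qed

lemma tent_nonneg [simp]: "0 \<le> tent p k"
  by (simp add: tent_def)

lemma tent_eq_0: "p \<notin> cell k \<Longrightarrow> tent p k = 0"
  by (simp add: tent_def cell_def)

lemma abs_tent_diff_le: "\<bar>tent p k - tent p l\<bar> \<le> 2 * bracket (k - l)"
proof -
  have "\<bar>lnorm (p - k) - lnorm (p - l)\<bar> \<le> lnorm (k - l)"
    using norm_triangle_ineq3[of "rvec (p - k)" "rvec (p - l)"]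
    by (simp add: rvec_diff norm_minus_commute)
  moreover have "\<bar>max 0 x - max 0 y\<bar> \<le> \<bar>x - y\<bar>" for x y :: real
    by (simp add: max_def)
  ultimately show ?thesis
    using abs_rad_diff_le[of k l] unfolding tent_def bracket_def by (smt (verit))
qed

lemma cell_eq_image: "cell k = (\<lambda>h. k + h) ` {h. lnorm h \<le> rad k}"
proof -
  have "p \<in> (\<lambda>h. k + h) ` {h. lnorm h \<le> rad k}" if "lnorm (p - k) \<le> rad k" for p
    using that by (intro image_eqI[of _ _ "p - k"]) auto
  then show ?thesis by (auto simp: cell_def)
qed

lemma finite_cell [simp]: "finite (cell k)"
  by (simp add: cell_eq_image)

lemma card_cell_le: "real (card (cell (k :: int ^ 'n::finite))) \<le> (6 * rad k) ^ CARD('n)"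
proof -
  have "real (card (cell k)) = real (card {h :: int ^ 'n. lnorm h \<le> rad k})"
    unfolding cell_eq_image by (subst card_image) (auto simp: inj_on_def)
  also have "\<dots> \<le> (2 * rad k + 1) ^ CARD('n)"
    by (rule card_lnorm_ball_le) (simp add: less_imp_le)
  \<comment> \<open>As \<open>rad k\<close> is at least 1/4, the summand 1 is absorbed by
    \<open>4 * rad k\<close>.\<close>
  also have "\<dots> \<le> (6 * rad k) ^ CARD('n)"
    using rad_ge[of k] by (intro power_mono) auto
  finally show ?thesis .
qed

text \<open>On the concentric ball of half the radius the tent has at least half its maximal height,
  and that ball contains at least (r / 2n)^n points for r = \<open>rad k\<close>.\<close>

lemma mass_ge:
  fixes k :: "int ^ 'n::finite"
  shows "(1 / (2 * real CARD('n))) ^ CARD('n) / 4 * rad k ^ (CARD('n) + 2) \<le> mass k"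
proof -
  let ?S = "(\<lambda>h. k + h) ` {h. lnorm h \<le> rad k / 2}"
  have r: "0 < rad k" by simp
  have "(rad k / 2 / CARD('n)) ^ CARD('n) \<le> real (card {h :: int ^ 'n. lnorm h \<le> rad k / 2})"
    using r by (intro card_lnorm_ball_ge) auto
  also have "\<dots> = real (card ?S)"
    by (subst card_image) (auto simp: inj_on_def)
  finally have "(rad k / 2 / CARD('n)) ^ CARD('n) * (rad k / 2)\<^sup>2 \<le> (\<Sum>p\<in>?S. (rad k / 2)\<^sup>2)"
    by (simp add: mult_right_mono)
  also have "\<dots> \<le> (\<Sum>p\<in>?S. (tent p k)\<^sup>2)"
  proof (intro sum_mono power_mono)
    fix p assume "p \<in> ?S"
    then have "rad k / 2 \<le> rad k - lnorm (p - k)" by auto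
    then show "rad k / 2 \<le> tent p k" unfolding tent_def by (rule max.coboundedI2)
  qed simp
  also have "\<dots> \<le> mass k"
    unfolding mass_def
  proof (rule sum_mono2)
    have "lnorm h \<le> rad k" if "lnorm h \<le> rad k / 2" for h :: "int ^ 'n"
      using that r by linarith
    then show "?S \<subseteq> cell k" by (auto simp: cell_def)
  qed auto
  also have "(rad k / 2 / CARD('n)) ^ CARD('n) * (rad k / 2)\<^sup>2
      = (1 / (2 * real CARD('n))) ^ CARD('n) / 4 * rad k ^ (CARD('n) + 2)"
    by (simp add: power_add power_divide power_mult_distrib power2_eq_square)
  finally show ?thesis .
qed

lemma mass_pos [simp]: "0 < mass (k :: int ^ 'n::finite)"
  by (rule less_le_trans[OF _ mass_ge]) (simp add: zero_less_mult_iff zero_less_power)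

lemma mass_nz [simp]: "mass k \<noteq> 0"
  using mass_pos[of k] by linarith

lemma sum_tent_sq: "finite P \<Longrightarrow> cell k \<subseteq> P \<Longrightarrow> (\<Sum>p\<in>P. (tent p k)\<^sup>2) = mass k"
  unfolding mass_def by (rule sum.mono_neutral_right) (auto simp: tent_eq_0)

lemma sum_window_sq: "finite P \<Longrightarrow> cell k \<subseteq> P \<Longrightarrow> (\<Sum>p\<in>P. (window p k)\<^sup>2) = 1"
  using mass_pos[of k]
  by (simp add: window_def power_divide sum_tent_sq real_sqrt_pow2 less_imp_le flip: sum_divide_distrib)

lemma window_eq_0: "p \<notin> cell k \<Longrightarrow> window p k = 0"
  by (simp add: window_def tent_eq_0)

text \<open>For vectors of lengths U and V with inner product X, the normalised vectors have squared
  distance (2UV - 2X) / (UV), and 2UV - 2X is at most the squared distance of the vectors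
  themselves. This avoids estimating how \<open>mass\<close> varies. The Lipschitz bound and the
  size of the cells give a numerator of order at most J^(n+2) \<rho>^n, and the masses a denominator
  of order at least \<rho>^(n+2).\<close>

lemma sum_window_diff_sq_le:
  fixes k l :: "int ^ 'n::finite"
  defines "n \<equiv> CARD('n)"
  assumes P: "finite P" "cell k \<subseteq> P" "cell l \<subseteq> P"
  shows "(\<Sum>p\<in>P. (window p k - window p l)\<^sup>2)
    \<le> 512 * 6 ^ n * (2 * real n) ^ n * (bracket (k - l) ^ (n + 4) / bracket k)"
proof -
  define J where "J = bracket (k - l)"
  \<comment> \<open>The smaller radius bounds both masses from below, and the larger one exceeds it
    by at most the factor \<open>J\<close>.\<close>
  define \<rho> where "\<rho> = min (rad k) (rad l)"
  define c where "c = (1 / (2 * real n)) ^ n / 4"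
  have c: "0 < c" by (simp add: c_def n_def)
  have J: "1 \<le> J" by (simp add: J_def)
  have \<rho>: "0 < \<rho>" "\<rho> \<le> rad k" "\<rho> \<le> rad l" by (auto simp: \<rho>_def)
  have r\<rho>: "rad k \<le> \<rho> * J" "rad l \<le> \<rho> * J"
    using rad_le_mult[of k l] rad_le_mult[of l k] bracket_minus_commute[of k l]
      mult_left_mono[of 1 J "rad k"] mult_left_mono[of 1 J "rad l"] J
    by (auto simp: \<rho>_def J_def min_def less_imp_le)
  have "c * \<rho> ^ (n + 2) \<le> mass q" if "\<rho> \<le> rad q" for q :: "int ^ 'n"
  proof -
    have "c * \<rho> ^ (n + 2) \<le> c * rad q ^ (n + 2)"
      using that \<rho> c by (intro mult_left_mono power_mono) auto
    also have "\<dots> \<le> mass q" using mass_ge[of q] by (simp add: c_def n_def)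
    finally show ?thesis .
  qed
  with \<rho> have mass: "c * \<rho> ^ (n + 2) \<le> mass k" "c * \<rho> ^ (n + 2) \<le> mass l" by blast+
  define U where "U = sqrt (mass k)"
  define V where "V = sqrt (mass l)"
  have UV: "0 < U" "0 < V" "U\<^sup>2 = mass k" "V\<^sup>2 = mass l"
    by (auto simp: U_def V_def less_imp_le)
  have UVge: "c * \<rho> ^ (n + 2) \<le> U * V"
  proof -
    have "0 \<le> c * \<rho> ^ (n + 2)" using c \<rho> by simp
    then have "sqrt (c * \<rho> ^ (n + 2)) * sqrt (c * \<rho> ^ (n + 2)) \<le> U * V"
      unfolding U_def V_def using mass by (intro mult_mono) auto
    then show ?thesis using \<open>0 \<le> c * \<rho> ^ (n + 2)\<close> by simp
  qed
  define X where "X = (\<Sum>p\<in>P. tent p k * tent p l)"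
  have "(\<Sum>p\<in>P. (window p k - window p l)\<^sup>2)
      = (\<Sum>p\<in>P. (window p k)\<^sup>2) + (\<Sum>p\<in>P. (window p l)\<^sup>2) - 2 * X / (U * V)"
    unfolding X_def
    by (simp add: power2_diff sum.distrib sum_subtractf sum_distrib_left sum_divide_distrib
        window_def U_def V_def mult_ac)
  then have eq: "(\<Sum>p\<in>P. (window p k - window p l)\<^sup>2) = 2 - 2 * X / (U * V)"
    using P by (simp add: sum_window_sq)
  have "(\<Sum>p\<in>P. (tent p k - tent p l)\<^sup>2)
      = (\<Sum>p\<in>P. (tent p k)\<^sup>2) + (\<Sum>p\<in>P. (tent p l)\<^sup>2) - 2 * X"
    unfolding X_def
    by (simp add: power2_diff sum.distrib sum_subtractf sum_distrib_left mult_ac)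
  also have "\<dots> = U\<^sup>2 + V\<^sup>2 - 2 * X" using P by (simp add: sum_tent_sq UV)
  finally have diff: "2 * (U * V) - 2 * X \<le> (\<Sum>p\<in>P. (tent p k - tent p l)\<^sup>2)"
    using sum_squares_bound[of U V] by simp
  have "(\<Sum>p\<in>P. (tent p k - tent p l)\<^sup>2) = (\<Sum>p\<in>cell k \<union> cell l. (tent p k - tent p l)\<^sup>2)"
    using P by (intro sum.mono_neutral_right) (auto simp: tent_eq_0)
  also have "\<dots> \<le> (\<Sum>p\<in>cell k \<union> cell l. (2 * J)\<^sup>2)"
    by (intro sum_mono power2_le_iff_abs_le[THEN iffD2]) (use abs_tent_diff_le J in \<open>auto simp: J_def\<close>)
  also have "\<dots> = real (card (cell k \<union> cell l)) * (2 * J)\<^sup>2" by simp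
  also have "\<dots> \<le> (2 * (6 * (\<rho> * J)) ^ n) * (2 * J)\<^sup>2"
  proof (rule mult_right_mono)
    have "real (card (cell k \<union> cell l)) \<le> real (card (cell k)) + real (card (cell l))"
      using card_Un_le[of "cell k" "cell l"] by linarith
    also have "\<dots> \<le> (6 * rad k) ^ n + (6 * rad l) ^ n"
      unfolding n_def by (intro add_mono card_cell_le)
    also have "\<dots> \<le> (6 * (\<rho> * J)) ^ n + (6 * (\<rho> * J)) ^ n"
      using r\<rho> by (intro add_mono power_mono mult_left_mono) (auto simp: less_imp_le)
    finally show "real (card (cell k \<union> cell l)) \<le> 2 * (6 * (\<rho> * J)) ^ n"
      by (simp only: mult_2)
  qed simp
  finally have num: "2 * (U * V) - 2 * X \<le> 8 * 6 ^ n * J ^ (n + 2) * \<rho> ^ n"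
    using diff by (simp add: power_mult_distrib power_add power2_eq_square mult_ac)
  \<comment> \<open>Returning from \<rho> to the weight at k costs the last two powers of
    \<open>J\<close>.\<close>
  have \<rho>2: "1 / \<rho>\<^sup>2 \<le> 16 * J\<^sup>2 / bracket k"
  proof -
    have "bracket k / 16 \<le> (\<rho> * J)\<^sup>2"
      unfolding rad_sq[symmetric] using r\<rho> by (intro power_mono) (auto simp: less_imp_le)
    then show ?thesis using \<rho> by (simp add: field_simps power_mult_distrib)
  qed
  have "2 - 2 * X / (U * V) = (2 * (U * V) - 2 * X) / (U * V)"
    using UV by (simp add: diff_divide_distrib)
  also have "\<dots> \<le> (8 * 6 ^ n * J ^ (n + 2) * \<rho> ^ n) / (U * V)"
    using UV num by (intro divide_right_mono) auto
  also have "\<dots> \<le> (8 * 6 ^ n * J ^ (n + 2) * \<rho> ^ n) / (c * \<rho> ^ (n + 2))"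
    using UVge UV c \<rho> J by (intro divide_left_mono) (auto intro!: mult_pos_pos)
  also have "\<dots> = (8 * 6 ^ n * J ^ (n + 2) / c) * (1 / \<rho>\<^sup>2)"
    using \<rho> by (simp add: power_add power2_eq_square)
  also have "\<dots> \<le> (8 * 6 ^ n * J ^ (n + 2) / c) * (16 * J\<^sup>2 / bracket k)"
    using J c by (intro mult_left_mono \<rho>2) auto
  also have "\<dots> = 512 * 6 ^ n * (2 * real n) ^ n * (J ^ (n + 4) / bracket k)"
    by (simp add: c_def power_add power_divide power2_eq_square field_simps numeral_eq_Suc)
  finally show ?thesis unfolding eq J_def .
qed

section \<open>Errors of averaging and of polarization\<close>

text \<open>The weights at k + h and k - h coincide, so the error is half an average of symmetric
  second differences. Each is at most a constant times the squared radius times a weight of order m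
  - 2, and the squared radius is 1/16 of the weight at k.\<close>

lemma window_average_le:
  fixes a :: "int ^ 'n::finite \<Rightarrow> complex"
  assumes A: "0 \<le> A" and a: "\<And>i j q. cmod (diff_op i (diff_op j a) q) \<le> A * bracket q powr (m - 2)"
    and P: "finite P" "cell k \<subseteq> P"
  shows "cmod (a k - (\<Sum>p\<in>P. (window p k)\<^sup>2 * a p))
    \<le> (real CARD('n))\<^sup>2 * 2 powr \<bar>m - 2\<bar> * A * bracket k powr (m - 1)"
proof -
  define H where "H = {h :: int ^ 'n. lnorm h \<le> rad k}"
  define M where "M = A * (2 powr \<bar>m - 2\<bar> * bracket k powr (m - 2))"
  have fin: "finite H" by (simp add: H_def)
  have w_neg: "window (k - h) k = window (k + h) k" for h
    by (simp add: window_def tent_def)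
  have reindex: "(\<Sum>p\<in>P. g p) = (\<Sum>h\<in>H. g (k + h))" if "\<And>p. p \<notin> cell k \<Longrightarrow> g p = 0"
    for g :: "int ^ 'n \<Rightarrow> complex"
  proof -
    have "(\<Sum>p\<in>P. g p) = (\<Sum>p\<in>cell k. g p)"
      by (rule sum.mono_neutral_right) (use P that in auto)
    then show ?thesis
      unfolding cell_eq_image H_def by (subst (asm) sum.reindex) (auto simp: inj_on_def)
  qed
  define w where "w = (\<lambda>h. complex_of_real ((window (k + h) k)\<^sup>2))"
  have "(\<Sum>p\<in>P. complex_of_real ((window p k)\<^sup>2)) = (\<Sum>h\<in>H. w h)"
    unfolding w_def by (rule reindex) (simp add: window_eq_0)
  then have w1: "(\<Sum>h\<in>H. w h) = 1"
    using sum_window_sq[OF P] unfolding of_real_sum[symmetric] by simp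
  have S: "(\<Sum>p\<in>P. (window p k)\<^sup>2 * a p) = (\<Sum>h\<in>H. w h * a (k + h))"
    unfolding w_def by (rule reindex) (simp add: window_eq_0)
  have "(\<Sum>h\<in>H. w h * a (k + h)) = (\<Sum>h\<in>H. w h * a (k - h))"
    by (rule sum.reindex_bij_witness[of _ uminus uminus]) (auto simp: H_def w_def w_neg)
  with S have S': "(\<Sum>p\<in>P. (window p k)\<^sup>2 * a p) = (\<Sum>h\<in>H. w h * a (k - h))"
    by simp
  have "(\<Sum>h\<in>H. w h * (2 * a k)) = 2 * a k"
    by (simp only: sum_distrib_right[symmetric] w1 mult_1)
  then have "(\<Sum>h\<in>H. w h * (a (k + h) + a (k - h) - 2 * a k))
      = - (2 * (a k - (\<Sum>p\<in>P. (window p k)\<^sup>2 * a p)))"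
    by (simp only: distrib_left right_diff_distrib sum.distrib sum_subtractf S[symmetric] S'[symmetric])
       simp
  then have "2 * cmod (a k - (\<Sum>p\<in>P. (window p k)\<^sup>2 * a p))
      = cmod (\<Sum>h\<in>H. w h * (a (k + h) + a (k - h) - 2 * a k))"
    by (simp only: norm_minus_cancel norm_mult norm_numeral)
  also have "\<dots> \<le> (\<Sum>h\<in>H. (window (k + h) k)\<^sup>2 * ((real CARD('n))\<^sup>2 * (rad k)\<^sup>2 * M))"
  proof (rule sum_norm_le)
    fix h assume "h \<in> H"
    then have h: "lnorm h \<le> rad k" by (simp add: H_def)
    have "cmod (a (k + h) + a (k - h) - 2 * a k) \<le> (real CARD('n))\<^sup>2 * (lnorm h)\<^sup>2 * M"
    proof (rule second_diff_le)
      fix i j q assume "lnorm (q - k) \<le> 2 * lnorm h"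
      then have "lnorm (q - k) \<le> bracket k / 2" using h two_rad_le[of k] by linarith
      then show "cmod (diff_op i (diff_op j a) q) \<le> M"
        unfolding M_def by (intro order_trans[OF a] mult_left_mono bracket_near A)
    qed
    also have "\<dots> \<le> (real CARD('n))\<^sup>2 * (rad k)\<^sup>2 * M"
      using h A by (intro mult_left_mono mult_right_mono power_mono) (auto simp: M_def)
    finally show "cmod (w h * (a (k + h) + a (k - h) - 2 * a k))
        \<le> (window (k + h) k)\<^sup>2 * ((real CARD('n))\<^sup>2 * (rad k)\<^sup>2 * M)"
      unfolding norm_mult w_def by (intro mult_mono) (auto simp: norm_power)
  qed
  also have "\<dots> = (real CARD('n))\<^sup>2 * (rad k)\<^sup>2 * M"
  proof -
    have "complex_of_real (\<Sum>h\<in>H. (window (k + h) k)\<^sup>2) = 1" using w1 by (simp add: w_def)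
    then have "(\<Sum>h\<in>H. (window (k + h) k)\<^sup>2) = 1" using of_real_eq_1_iff by blast
    then show ?thesis by (simp flip: sum_distrib_right)
  qed
  also have "\<dots> = (real CARD('n))\<^sup>2 * 2 powr \<bar>m - 2\<bar> * A * (bracket k * bracket k powr (m - 2)) / 16"
    by (simp add: M_def rad_sq)
  also have "bracket k * bracket k powr (m - 2) = bracket k powr (m - 1)"
    using powr_add[of "bracket k" 1 "m - 2"] by simp
  finally have "2 * cmod (a k - (\<Sum>p\<in>P. (window p k)\<^sup>2 * a p))
      \<le> (real CARD('n))\<^sup>2 * 2 powr \<bar>m - 2\<bar> * A * bracket k powr (m - 1) / 16" .
  moreover have "0 \<le> (real CARD('n))\<^sup>2 * 2 powr \<bar>m - 2\<bar> * A * bracket k powr (m - 1)"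
    using A by simp
  ultimately show ?thesis by linarith
qed

text \<open>The first summand stems from the two averages, the second from the distance of two
  windows; 256 is half of the 512 found there, the polarization identity halving that term.\<close>

definition symm_const :: "'n::finite itself \<Rightarrow> real \<Rightarrow> real" where
  "symm_const _ m = (real CARD('n))\<^sup>2 * 2 powr \<bar>m - 2\<bar>
     + 256 * 6 ^ CARD('n) * (2 * real CARD('n)) ^ CARD('n) * 2 powr \<bar>m\<bar>"

text \<open>Here \<open>a\<close> is the coefficient at one fixed frequency, whose decay is hidden
  in \<open>A\<close>. The loss in \<open>bracket (k - l)\<close> consists of K powers for moving
  the weight from l to k and n + 4 powers for the distance of two windows.\<close>

lemma symmetrization_error:
  fixes a :: "int ^ 'n::finite \<Rightarrow> complex"
  assumes A: "0 \<le> A" and a0: "\<And>q. cmod (a q) \<le> A * bracket q powr m"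
    and a2: "\<And>i j q. cmod (diff_op i (diff_op j a) q) \<le> A * bracket q powr (m - 2)"
    and K: "\<bar>m\<bar> + 1 \<le> real K"
    and P: "finite P" "cell k \<subseteq> P" "cell l \<subseteq> P"
  shows "cmod ((a k + a l) / 2 - (\<Sum>p\<in>P. of_real (window p k * window p l) * a p))
    \<le> symm_const TYPE('n) m * A * bracket k powr (m - 1) * bracket (k - l) ^ (K + CARD('n) + 4)"
proof -
  define J where "J = bracket (k - l)"
  define C1 where "C1 = (real CARD('n))\<^sup>2 * 2 powr \<bar>m - 2\<bar>"
  define C2 where "C2 = 512 * 6 ^ CARD('n) * (2 * real CARD('n)) ^ CARD('n)"
  define c where "c = 2 powr \<bar>m\<bar>"
  have C: "0 \<le> C1" "0 \<le> C2" "0 \<le> c" by (simp_all add: C1_def C2_def c_def)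
  have J: "1 \<le> J" by (simp add: J_def)
  define Sk Sl T where "Sk = (\<Sum>p\<in>P. (window p k)\<^sup>2 * a p)" and "Sl = (\<Sum>p\<in>P. (window p l)\<^sup>2 * a p)"
    and "T = (\<Sum>p\<in>P. of_real ((window p k - window p l)\<^sup>2) * a p)"
  have "(\<Sum>p\<in>P. of_real (window p k * window p l) * a p)
      = (\<Sum>p\<in>P. (of_real ((window p k)\<^sup>2) * a p + of_real ((window p l)\<^sup>2) * a p
          - of_real ((window p k - window p l)\<^sup>2) * a p) / 2)"
    by (intro sum.cong refl) (simp add: power2_diff field_simps)
  also have "\<dots> = (Sk + Sl - T) / 2"
    unfolding Sk_def Sl_def T_def by (simp add: sum.distrib sum_subtractf flip: sum_divide_distrib)
  finally have eq: "(a k + a l) / 2 - (\<Sum>p\<in>P. of_real (window p k * window p l) * a p)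
      = ((a k - Sk) + (a l - Sl) + T) / 2"
    by (simp only: diff_divide_distrib[symmetric]) (simp add: algebra_simps)
  define B where "B = A * bracket k powr (m - 1) * J ^ (K + CARD('n) + 4)"
  have JK: "J ^ e \<le> J ^ (K + CARD('n) + 4)" if "e \<le> K + CARD('n) + 4" for e
    using that J by (intro power_increasing) auto
  have 1: "cmod (a k - Sk) \<le> C1 * B"
  proof -
    have "cmod (a k - Sk) \<le> C1 * (A * bracket k powr (m - 1) * 1)"
      using window_average_le[OF A a2 P(1,2)] by (simp add: C1_def Sk_def mult_ac)
    also have "\<dots> \<le> C1 * B"
      unfolding B_def using C A JK[of 0] by (intro mult_left_mono) auto
    finally show ?thesis .
  qed
  have 2: "cmod (a l - Sl) \<le> C1 * B"
  proof -
    have "cmod (a l - Sl) \<le> C1 * (A * bracket l powr (m - 1))"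
      using window_average_le[OF A a2 P(1,3)] by (simp add: C1_def Sl_def mult_ac)
    also have "\<dots> \<le> C1 * (A * (bracket (l - k) ^ K * bracket k powr (m - 1)))"
      using C A K by (intro mult_left_mono peetre) auto
    also have "\<dots> = C1 * (A * bracket k powr (m - 1) * J ^ K)"
      by (simp add: J_def bracket_minus_commute mult_ac)
    also have "\<dots> \<le> C1 * B"
      unfolding B_def using C A by (intro mult_left_mono JK) auto
    finally show ?thesis .
  qed
  have 3: "cmod T \<le> C2 * c * B"
  proof -
    define M where "M = A * (c * (J ^ K * bracket k powr m))"
    \<comment> \<open>Outside both cells the two windows vanish; inside a cell the weight is
      comparable to that at its centre.\<close>
    have near: "cmod (a p) \<le> M" if "p \<in> cell k \<union> cell l" for p
    proof -
      have "bracket p powr m \<le> c * (J ^ K * bracket k powr m)"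
      proof (cases "p \<in> cell k")
        case True
        then have "lnorm (p - k) \<le> bracket k / 2"
          using two_rad_le[of k] rad_pos[of k] unfolding cell_def mem_Collect_eq by linarith
        then have "bracket p powr m \<le> c * (1 * bracket k powr m)" unfolding c_def by (simp add: bracket_near)
        also have "\<dots> \<le> c * (J ^ K * bracket k powr m)"
          using J C by (intro mult_left_mono mult_right_mono) auto
        finally show ?thesis .
      next
        case False
        then have "lnorm (p - l) \<le> bracket l / 2"
          using that two_rad_le[of l] rad_pos[of l] unfolding cell_def Un_iff mem_Collect_eq by linarith
        then have "bracket p powr m \<le> c * bracket l powr m" unfolding c_def by (rule bracket_near)
        also have "\<dots> \<le> c * (bracket (l - k) ^ K * bracket k powr m)"
          using K C by (intro mult_left_mono peetre) auto
        finally show ?thesis by (simp add: J_def bracket_minus_commute)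
      qed
      then show ?thesis unfolding M_def by (intro order_trans[OF a0] mult_left_mono A)
    qed
    have M: "0 \<le> M" using A C J by (simp add: M_def)
    have "cmod T \<le> (\<Sum>p\<in>P. (window p k - window p l)\<^sup>2 * M)"
      unfolding T_def
    proof (rule sum_norm_le)
      fix p
      have "(window p k - window p l)\<^sup>2 * cmod (a p) \<le> (window p k - window p l)\<^sup>2 * M"
        using near[of p] by (cases "p \<in> cell k \<union> cell l") (auto intro: mult_left_mono simp: window_eq_0)
      then show "cmod (of_real ((window p k - window p l)\<^sup>2) * a p) \<le> (window p k - window p l)\<^sup>2 * M"
        unfolding norm_mult norm_of_real by simp
    qed
    also have "\<dots> = (\<Sum>p\<in>P. (window p k - window p l)\<^sup>2) * M" by (simp add: sum_distrib_right)
    also have "\<dots> \<le> C2 * (J ^ (CARD('n) + 4) / bracket k) * M"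
      unfolding C2_def J_def by (intro mult_right_mono sum_window_diff_sq_le P M)
    also have "\<dots> = C2 * c * (A * (bracket k powr m / bracket k) * J ^ (K + CARD('n) + 4))"
      by (simp add: M_def power_add)
    also have "bracket k powr m / bracket k = bracket k powr (m - 1)"
      using powr_diff[of "bracket k" m 1] by simp
    finally show ?thesis by (simp add: B_def)
  qed
  have "cmod ((a k - Sk) + (a l - Sl) + T) \<le> cmod (a k - Sk) + cmod (a l - Sl) + cmod T"
    using norm_triangle_ineq[of "(a k - Sk) + (a l - Sl)" T]
      norm_triangle_ineq[of "a k - Sk" "a l - Sl"] by linarith
  also have "\<dots> \<le> C1 * B + C1 * B + C2 * c * B" by (intro add_mono 1 2 3)
  also have "\<dots> = 2 * (symm_const TYPE('n) m * B)"
    by (simp add: symm_const_def C1_def C2_def c_def algebra_simps)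
  finally have "cmod (((a k - Sk) + (a l - Sl) + T) / 2) \<le> symm_const TYPE('n) m * B"
    by (simp add: norm_divide)
  then show ?thesis unfolding eq B_def J_def by (simp add: mult.assoc)
qed

subsection \<open>The quadratic form of a symbol\<close>

lemma echar_diff: "echar (k - l) x = echar k x * cnj (echar l x)"
proof -
  have "cnj (echar l x) = exp (- (2 * of_real pi * \<i> * of_real (rvec l \<bullet> x)))"
    by (simp add: echar_def exp_cnj)
  then show ?thesis
    by (simp add: echar_def rvec_diff inner_diff_left algebra_simps flip: exp_add exp_diff)
qed

lemma cnj_echar: "cnj (echar k x) = echar (- k) x"
  using echar_diff[of 0 k x] by (simp add: echar_def)

lemma cnj_fcoeff:
  assumes "continuous_on UNIV u" and "\<And>x. u x \<in> \<real>"
  shows "cnj (fcoeff u \<xi>) = fcoeff u (- \<xi>)"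
proof -
  have "cnj (fcoeff u \<xi>) = integral (cbox 0 One) (cnj \<circ> (\<lambda>x. u x * echar \<xi> x))"
    unfolding fcoeff_def torus_integral_def
    by (rule integral_linear[symmetric, OF echar_integrable[OF assms(1)] bounded_linear_cnj])
  also have "cnj \<circ> (\<lambda>x. u x * echar \<xi> x) = (\<lambda>x. u x * echar (- \<xi>) x)"
    using assms(2) by (auto simp: cnj_echar Reals_cnj_iff)
  finally show ?thesis by (simp add: fcoeff_def torus_integral_def)
qed

text \<open>The form equals the integral of u times the squared modulus of the trigonometric
  polynomial \<open>G\<close>.\<close>

lemma fcoeff_form_nonneg:
  fixes g :: "int ^ 'n::finite \<Rightarrow> complex"
  assumes cont: "continuous_on UNIV u" and u: "\<And>x. u x \<in> \<real>\<^sub>\<ge>\<^sub>0" and S: "finite S"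
  shows "0 \<le> Re (\<Sum>k\<in>S. \<Sum>l\<in>S. fcoeff u (k - l) * (g l * cnj (g k)))"
proof -
  define G where "G = (\<lambda>x. \<Sum>l\<in>S. g l * cnj (echar l x))"
  let ?v = "\<lambda>x. u x * of_real ((cmod (G x))\<^sup>2)"
  have "((\<lambda>x. \<Sum>k\<in>S. \<Sum>l\<in>S. u x * echar (k - l) x * (g l * cnj (g k))) has_integral
      (\<Sum>k\<in>S. \<Sum>l\<in>S. fcoeff u (k - l) * (g l * cnj (g k)))) (cbox 0 One)"
    unfolding fcoeff_def torus_integral_def
    by (intro has_integral_sum S has_integral_mult_left integrable_integral echar_integrable cont)
  moreover have "(\<Sum>k\<in>S. \<Sum>l\<in>S. u x * echar (k - l) x * (g l * cnj (g k))) = ?v x" for x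
  proof -
    have "(\<Sum>k\<in>S. \<Sum>l\<in>S. u x * echar (k - l) x * (g l * cnj (g k)))
        = u x * ((\<Sum>k\<in>S. cnj (g k) * echar k x) * (\<Sum>l\<in>S. g l * cnj (echar l x)))"
      unfolding sum_product by (simp add: sum_distrib_left echar_diff mult_ac)
    also have "(\<Sum>k\<in>S. cnj (g k) * echar k x) = cnj (G x)" by (simp add: G_def)
    also have "(\<Sum>l\<in>S. g l * cnj (echar l x)) = G x" by (simp add: G_def)
    finally show ?thesis by (simp only: complex_norm_square mult_ac)
  qed
  ultimately have int: "(?v has_integral
      (\<Sum>k\<in>S. \<Sum>l\<in>S. fcoeff u (k - l) * (g l * cnj (g k)))) (cbox 0 One)"
    by simp
  from has_integral_linear[OF this bounded_linear_Re]
  have "((\<lambda>x. Re (?v x)) has_integral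
      Re (\<Sum>k\<in>S. \<Sum>l\<in>S. fcoeff u (k - l) * (g l * cnj (g k)))) (cbox 0 One)"
    by (simp only: comp_def)
  moreover have "0 \<le> Re (?v x)" for x
    using u[of x] by (auto elim!: nonneg_Reals_cases)
  ultimately show ?thesis by (rule has_integral_nonneg)
qed

section \<open>Schur's test and the distribution of weights\<close>

text \<open>The inequality of arithmetic and geometric means splits each product into a square at k
  and a square at l; by symmetry of the kernel both halves reduce to its row sums.\<close>

lemma schur_bound:
  fixes g :: "int ^ 'n::finite \<Rightarrow> real"
  assumes C: "\<And>S :: (int ^ 'n) set. finite S \<Longrightarrow> (\<Sum>h\<in>S. 1 / bracket h ^ (2 * CARD('n))) \<le> C"
    and T: "finite T"
  shows "(\<Sum>k\<in>T. \<Sum>l\<in>T. g k * g l / bracket (k - l) ^ (2 * CARD('n))) \<le> C * (\<Sum>k\<in>T. (g k)\<^sup>2)"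
proof -
  let ?w = "\<lambda>k l. 1 / bracket (k - l) ^ (2 * CARD('n))"
  have row: "(\<Sum>k\<in>T. \<Sum>l\<in>T. (g k)\<^sup>2 * ?w k l) \<le> C * (\<Sum>k\<in>T. (g k)\<^sup>2)"
  proof -
    have "(\<Sum>l\<in>T. ?w k l) \<le> C" for k
    proof -
      have "(\<Sum>l\<in>T. ?w k l) = (\<Sum>h\<in>(\<lambda>l. k - l) ` T. 1 / bracket h ^ (2 * CARD('n)))"
        by (subst sum.reindex) (auto simp: inj_on_def)
      then show ?thesis using C[of "(\<lambda>l. k - l) ` T"] T by simp
    qed
    then have "(\<Sum>k\<in>T. (g k)\<^sup>2 * (\<Sum>l\<in>T. ?w k l)) \<le> (\<Sum>k\<in>T. (g k)\<^sup>2 * C)"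
      by (intro sum_mono mult_left_mono) auto
    then show ?thesis by (simp add: sum_distrib_left mult.commute)
  qed
  have "(\<Sum>k\<in>T. \<Sum>l\<in>T. g k * g l * ?w k l)
      \<le> (\<Sum>k\<in>T. \<Sum>l\<in>T. ((g k)\<^sup>2 * ?w k l + (g l)\<^sup>2 * ?w l k) / 2)"
  proof (intro sum_mono)
    fix k l
    have "g k * g l * ?w k l \<le> ((g k)\<^sup>2 + (g l)\<^sup>2) / 2 * ?w k l"
      using sum_squares_bound[of "g k" "g l"] by (intro mult_right_mono) auto
    then show "g k * g l * ?w k l \<le> ((g k)\<^sup>2 * ?w k l + (g l)\<^sup>2 * ?w l k) / 2"
      by (simp add: bracket_minus_commute[of l k] add_divide_distrib)
  qed
  also have "\<dots> = ((\<Sum>k\<in>T. \<Sum>l\<in>T. (g k)\<^sup>2 * ?w k l) + (\<Sum>k\<in>T. \<Sum>l\<in>T. (g l)\<^sup>2 * ?w l k)) / 2"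
    by (simp only: sum.distrib sum_divide_distrib add_divide_distrib)
  also have "(\<Sum>k\<in>T. \<Sum>l\<in>T. (g l)\<^sup>2 * ?w l k) = (\<Sum>k\<in>T. \<Sum>l\<in>T. (g k)\<^sup>2 * ?w k l)"
    by (rule sum.swap)
  finally show ?thesis using row by simp
qed

lemma form_bound:
  fixes E :: "int ^ 'n::finite \<Rightarrow> int ^ 'n \<Rightarrow> complex"
  assumes C: "\<And>S :: (int ^ 'n) set. finite S \<Longrightarrow> (\<Sum>h\<in>S. 1 / bracket h ^ (2 * CARD('n))) \<le> C"
    and T: "finite T" and B: "0 \<le> B"
    and E: "\<And>k l. k \<in> T \<Longrightarrow> l \<in> T \<Longrightarrow>
      cmod (E k l) \<le> B * (bracket k powr (s / 2) * bracket l powr (s / 2)) / bracket (k - l) ^ (2 * CARD('n))"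
  shows "cmod (\<Sum>k\<in>T. \<Sum>l\<in>T. E k l * (f l * cnj (f k)))
    \<le> B * C * (\<Sum>k\<in>T. bracket k powr s * (cmod (f k))\<^sup>2)"
proof -
  define g where "g = (\<lambda>k. bracket k powr (s / 2) * cmod (f k))"
  have "cmod (\<Sum>k\<in>T. \<Sum>l\<in>T. E k l * (f l * cnj (f k)))
      \<le> (\<Sum>k\<in>T. \<Sum>l\<in>T. cmod (E k l * (f l * cnj (f k))))"
    by (rule order_trans[OF norm_sum sum_mono[OF norm_sum]])
  also have "\<dots> \<le> (\<Sum>k\<in>T. \<Sum>l\<in>T. B * (g k * g l / bracket (k - l) ^ (2 * CARD('n))))"
  proof (intro sum_mono)
    fix k l assume kl: "k \<in> T" "l \<in> T"
    have "cmod (E k l * (f l * cnj (f k)))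
        \<le> B * (bracket k powr (s / 2) * bracket l powr (s / 2)) / bracket (k - l) ^ (2 * CARD('n)) * (cmod (f l) * cmod (f k))"
      unfolding norm_mult complex_mod_cnj by (intro mult_right_mono E kl) auto
    also have "\<dots> = B * (g k * g l / bracket (k - l) ^ (2 * CARD('n)))"
      by (simp add: g_def mult_ac)
    finally show "cmod (E k l * (f l * cnj (f k))) \<le> \<dots>" .
  qed
  also have "\<dots> = B * (\<Sum>k\<in>T. \<Sum>l\<in>T. g k * g l / bracket (k - l) ^ (2 * CARD('n)))"
    by (simp only: sum_distrib_left)
  also have "\<dots> \<le> B * (C * (\<Sum>k\<in>T. (g k)\<^sup>2))"
    by (intro mult_left_mono schur_bound C T B)
  also have "(\<Sum>k\<in>T. (g k)\<^sup>2) = (\<Sum>k\<in>T. bracket k powr s * (cmod (f k))\<^sup>2)"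
    by (intro sum.cong refl) (simp add: g_def power_mult_distrib powr_power mult.commute)
  finally show ?thesis by simp
qed

lemma powr_half_split:
  fixes k l :: "int ^ 'n::finite"
  assumes "\<bar>s\<bar> \<le> real K"
  shows "bracket k powr s \<le> bracket k powr (s / 2) * bracket l powr (s / 2) * bracket (k - l) ^ K"
proof -
  have "bracket k powr s = bracket k powr (s / 2) * bracket k powr (s / 2)" by (simp flip: powr_add)
  also have "\<dots> \<le> bracket k powr (s / 2) * (bracket (k - l) ^ K * bracket l powr (s / 2))"
    using assms by (intro mult_left_mono peetre) auto
  finally show ?thesis by (simp add: mult_ac)
qed

text \<open>The decay is spent in three portions: e cancels a loss already incurred, K pays for
  sharing the weight equally between k and l, and d is left for summability.\<close>

lemma weight_bound:
  fixes k l :: "int ^ 'n::finite"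
  assumes "\<bar>s\<bar> \<le> real K" "0 \<le> A" "x \<le> A * bracket k powr s * bracket (k - l) ^ e / bracket (k - l) ^ (e + K + d)"
  shows "x \<le> A * (bracket k powr (s / 2) * bracket l powr (s / 2)) / bracket (k - l) ^ d"
proof -
  have "x \<le> A * bracket k powr s / bracket (k - l) ^ (K + d)"
    using assms(3) by (simp add: power_add)
  also have "\<dots> \<le> A * (bracket k powr (s / 2) * bracket l powr (s / 2) * bracket (k - l) ^ K) / bracket (k - l) ^ (K + d)"
    using assms(1,2) by (intro divide_right_mono mult_left_mono powr_half_split) auto
  also have "\<dots> = A * (bracket k powr (s / 2) * bracket l powr (s / 2)) / bracket (k - l) ^ d"
    by (simp add: power_add)
  finally show ?thesis .
qed

text \<open>A real symbol satisfies \<open>cnj (a p \<xi>) = a p (- \<xi>)\<close>, so the Hermitian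
  part of the matrix averages the symbol over row and column index, the quantity that symmetrization
  approximates. For each p the comparison form is a frozen one, evaluated at the sequence
  \<open>window p l * f l\<close>.\<close>

lemma nonneg_symbol_form_lower_bound:
  fixes \<sigma> :: "int ^ 'n::finite \<Rightarrow> real ^ 'n \<Rightarrow> complex" and m :: real
  assumes cont: "\<And>k. continuous_on UNIV (\<sigma> k)" and pos: "\<And>k x. \<sigma> k x \<in> \<real>\<^sub>\<ge>\<^sub>0"
    and K: "\<bar>m\<bar> + 1 \<le> real K" and N: "N = (K + CARD('n) + 4) + K + 2 * CARD('n)" and A: "0 \<le> A"
    and a0: "\<And>k \<xi>. cmod (fcoeff (\<sigma> k) \<xi>) \<le> A * bracket k powr m / bracket \<xi> ^ N"
    and a2: "\<And>i j k \<xi>. cmod (diff_op i (diff_op j (\<lambda>p. fcoeff (\<sigma> p) \<xi>)) k)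
       \<le> A * bracket k powr (m - 2) / bracket \<xi> ^ N"
    and C: "\<And>S :: (int ^ 'n) set. finite S \<Longrightarrow> (\<Sum>h\<in>S. 1 / bracket h ^ (2 * CARD('n))) \<le> C"
    and T: "finite T"
  shows "- (symm_const TYPE('n) m * A * C * (\<Sum>k\<in>T. bracket k powr (m - 1) * (cmod (f k))\<^sup>2))
    \<le> Re (\<Sum>k\<in>T. \<Sum>l\<in>T. fcoeff (\<sigma> k) (k - l) * (f l * cnj (f k)))"
proof -
  define a where "a = (\<lambda>p \<xi>. fcoeff (\<sigma> p) \<xi>)"
  define P where "P = (\<Union>k\<in>T. cell k)"
  define b where "b = (\<lambda>k l. \<Sum>p\<in>P. of_real (window p k * window p l) * a p (k - l))"
  define E where "E = (\<lambda>k l. (a k (k - l) + a l (k - l)) / 2 - b k l)"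
  define Q where "Q = (\<Sum>k\<in>T. \<Sum>l\<in>T. a k (k - l) * (f l * cnj (f k)))"
  have cnj_a: "cnj (a p \<xi>) = a p (- \<xi>)" for p \<xi>
    unfolding a_def using pos nonneg_Reals_subset_Reals by (intro cnj_fcoeff cont) blast
  have "cnj Q = (\<Sum>k\<in>T. \<Sum>l\<in>T. a k (l - k) * (f k * cnj (f l)))"
    unfolding Q_def cnj_sum by (simp add: cnj_a mult_ac)
  also have "\<dots> = (\<Sum>k\<in>T. \<Sum>l\<in>T. a l (k - l) * (f l * cnj (f k)))"
    by (rule sum.swap)
  finally have "Q + cnj Q = (\<Sum>k\<in>T. \<Sum>l\<in>T. (a k (k - l) + a l (k - l)) * (f l * cnj (f k)))"
    unfolding Q_def by (simp add: sum.distrib distrib_right)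
  also have "\<dots> = (\<Sum>k\<in>T. \<Sum>l\<in>T. 2 * (E k l * (f l * cnj (f k)) + b k l * (f l * cnj (f k))))"
    by (intro sum.cong refl) (simp add: E_def algebra_simps)
  also have "\<dots> = 2 * ((\<Sum>k\<in>T. \<Sum>l\<in>T. E k l * (f l * cnj (f k)))
      + (\<Sum>k\<in>T. \<Sum>l\<in>T. b k l * (f l * cnj (f k))))"
    by (simp only: sum.distrib sum_distrib_left[symmetric])
  finally have "Re (Q + cnj Q) = 2 * Re ((\<Sum>k\<in>T. \<Sum>l\<in>T. E k l * (f l * cnj (f k)))
      + (\<Sum>k\<in>T. \<Sum>l\<in>T. b k l * (f l * cnj (f k))))"
    by simp
  then have ReQ: "Re Q = Re (\<Sum>k\<in>T. \<Sum>l\<in>T. E k l * (f l * cnj (f k)))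
      + Re (\<Sum>k\<in>T. \<Sum>l\<in>T. b k l * (f l * cnj (f k)))"
    unfolding plus_complex.sel complex_cnj by simp
  have "0 \<le> Re (\<Sum>k\<in>T. \<Sum>l\<in>T. b k l * (f l * cnj (f k)))"
  proof -
    have "(\<Sum>k\<in>T. \<Sum>l\<in>T. b k l * (f l * cnj (f k)))
        = (\<Sum>k\<in>T. \<Sum>l\<in>T. \<Sum>p\<in>P. a p (k - l) * ((window p l * f l) * cnj (window p k * f k)))"
      unfolding b_def sum_distrib_right by (intro sum.cong refl) simp
    also have "\<dots> = (\<Sum>k\<in>T. \<Sum>p\<in>P. \<Sum>l\<in>T. a p (k - l) * ((window p l * f l) * cnj (window p k * f k)))"
      by (intro sum.cong refl sum.swap)
    also have "\<dots> = (\<Sum>p\<in>P. \<Sum>k\<in>T. \<Sum>l\<in>T. a p (k - l) * ((window p l * f l) * cnj (window p k * f k)))"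
      by (rule sum.swap)
    finally show ?thesis
      unfolding a_def
      by (elim ssubst) (subst Re_sum, intro sum_nonneg fcoeff_form_nonneg cont pos T)
  qed
  moreover have "cmod (\<Sum>k\<in>T. \<Sum>l\<in>T. E k l * (f l * cnj (f k)))
    \<le> symm_const TYPE('n) m * A * C * (\<Sum>k\<in>T. bracket k powr (m - 1) * (cmod (f k))\<^sup>2)"
  proof (rule form_bound[OF C T])
    have sc: "0 \<le> symm_const TYPE('n) m" by (simp add: symm_const_def)
    then show nonneg: "0 \<le> symm_const TYPE('n) m * A" using A by simp
    fix k l assume kl: "k \<in> T" "l \<in> T"
    \<comment> \<open>For fixed k and l the frequency k - l is fixed too, so its decay acts as a
      constant in the symmetrization estimate.\<close>
    define A' where "A' = A / bracket (k - l) ^ N"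
    have "cmod (E k l) \<le> symm_const TYPE('n) m * A' * bracket k powr (m - 1) * bracket (k - l) ^ (K + CARD('n) + 4)"
      unfolding E_def b_def
    proof (rule symmetrization_error)
      show "0 \<le> A'" using A by (simp add: A'_def)
      show "cmod (a q (k - l)) \<le> A' * bracket q powr m" for q
        using a0[of q "k - l"] by (simp add: a_def A'_def)
      show "cmod (diff_op i (diff_op j (\<lambda>p. a p (k - l))) q) \<le> A' * bracket q powr (m - 2)" for i j q
        using a2[of i j "k - l" q] by (simp add: a_def A'_def)
    qed (use K T kl in \<open>auto simp: P_def\<close>)
    then show "cmod (E k l) \<le> symm_const TYPE('n) m * A *
        (bracket k powr ((m - 1) / 2) * bracket l powr ((m - 1) / 2)) / bracket (k - l) ^ (2 * CARD('n))"
      using K nonneg by (intro weight_bound[where e = "K + CARD('n) + 4" and K = K]) (auto simp: A'_def N)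
  qed
  ultimately show ?thesis
    using ReQ abs_Re_le_cmod[of "\<Sum>k\<in>T. \<Sum>l\<in>T. E k l * (f l * cnj (f k))"]
    unfolding Q_def a_def by simp
qed

subsection \<open>Cutoffs\<close>

definition cutoff :: "real \<Rightarrow> int ^ 'n::finite \<Rightarrow> real" where
  "cutoff R k = max 0 (min 1 (2 - bracket k / R))"

lemma cutoff_bounds [simp]: "0 \<le> cutoff R k" "cutoff R k \<le> 1"
  by (auto simp: cutoff_def)

lemma cutoff_eq_1: "0 < R \<Longrightarrow> bracket k \<le> R \<Longrightarrow> cutoff R k = 1"
  by (simp add: cutoff_def min_def field_simps)

lemma cutoff_eq_0: "0 < R \<Longrightarrow> 2 * R < bracket k \<Longrightarrow> cutoff R k = 0"
  by (simp add: cutoff_def max_def min_def field_simps)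

lemma finite_bracket_le: "finite {k :: int ^ 'n::finite. bracket k \<le> R}"
  using finite_lnorm_ball[of "R - 1"] by (simp add: bracket_def algebra_simps)

text \<open>The cutoff has Lipschitz constant \<open>1/R\<close>, comparable to the inverse weight near its support; far outside,
  the difference vanishes unless the distance of \<open>k\<close> and \<open>l\<close> is comparable to the weight at \<open>k\<close>.\<close>
lemma bracket_mult_cutoff_diff_le:
  assumes R: "0 < R"
  shows "bracket k * \<bar>cutoff R k - cutoff R l\<bar> \<le> 4 * bracket (k - l)"
proof -
  define u where "u = bracket k / R"
  define v where "v = bracket l / R"
  define c where "c = (\<lambda>t :: real. max 0 (min 1 (2 - t)))"
  have u: "0 \<le> u" using R by (simp add: u_def)
  have lip: "\<bar>c u - c v\<bar> \<le> \<bar>u - v\<bar>" unfolding c_def by (simp add: max_def min_def abs_minus_commute)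
  have "u * \<bar>c u - c v\<bar> \<le> 4 * \<bar>u - v\<bar>"
  proof (cases "u \<le> 4")
    case True
    have "u * \<bar>c u - c v\<bar> \<le> 4 * \<bar>u - v\<bar>" using u True lip by (intro mult_mono) auto
    then show ?thesis .
  next
    case False
    show ?thesis
    proof (cases "v < 2")
      case True
      have "u * \<bar>c u - c v\<bar> \<le> u * 1" using u by (intro mult_left_mono) (auto simp: c_def)
      then show ?thesis using True False abs_ge_self[of "u - v"] by argo
    next
      case False
      with \<open>\<not> u \<le> 4\<close> have "c u = c v" by (simp add: c_def)
      then show ?thesis by simp
    qed
  qed
  then have "R * (u * \<bar>c u - c v\<bar>) \<le> R * (4 * \<bar>u - v\<bar>)"
    using R by (intro mult_left_mono) auto
  moreover have "R * (u * \<bar>c u - c v\<bar>) = bracket k * \<bar>cutoff R k - cutoff R l\<bar>"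
    using R by (simp add: u_def v_def c_def cutoff_def)
  moreover have "R * (4 * \<bar>u - v\<bar>) = 4 * \<bar>bracket k - bracket l\<bar>"
    using R by (simp add: u_def v_def abs_divide flip: diff_divide_distrib)
  moreover have "\<bar>bracket k - bracket l\<bar> \<le> bracket (k - l)"
    using norm_triangle_ineq3[of "rvec k" "rvec l"] by (simp add: bracket_def rvec_diff)
  ultimately show ?thesis by argo
qed

text \<open>The squared cutoff sits on the row index alone, which leaves the column sums free to be
  extended to the whole lattice. Moving one factor from row to column yields the form of the
  truncated sequence \<open>F\<close> plus the commutator term with entries
  \<open>E\<close>.\<close>

lemma truncated_form_lower_bound:
  fixes \<sigma> :: "int ^ 'n::finite \<Rightarrow> real ^ 'n \<Rightarrow> complex" and m :: real
  assumes cont: "\<And>k. continuous_on UNIV (\<sigma> k)" and pos: "\<And>k x. \<sigma> k x \<in> \<real>\<^sub>\<ge>\<^sub>0"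
    and K: "\<bar>m\<bar> + 1 \<le> real K" and N: "N = (K + CARD('n) + 4) + K + 2 * CARD('n)" and A: "0 \<le> A"
    and a0: "\<And>k \<xi>. cmod (fcoeff (\<sigma> k) \<xi>) \<le> A * bracket k powr m / bracket \<xi> ^ N"
    and a2: "\<And>i j k \<xi>. cmod (diff_op i (diff_op j (\<lambda>p. fcoeff (\<sigma> p) \<xi>)) k)
       \<le> A * bracket k powr (m - 2) / bracket \<xi> ^ N"
    and C0: "0 \<le> C"
    and C: "\<And>S :: (int ^ 'n) set. finite S \<Longrightarrow> (\<Sum>h\<in>S. 1 / bracket h ^ (2 * CARD('n))) \<le> C"
    and T: "finite T" and R: "0 < R"
  shows "- ((symm_const TYPE('n) m + 4) * A * C * (\<Sum>k\<in>T. bracket k powr (m - 1) * (cmod (f k))\<^sup>2))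
    \<le> Re (\<Sum>k\<in>T. (cutoff R k)\<^sup>2 * ((\<Sum>l\<in>T. fcoeff (\<sigma> k) (k - l) * f l) * cnj (f k)))"
proof -
  define \<eta> where "\<eta> = (\<lambda>k :: int ^ 'n. cutoff R k)"
  define a where "a = (\<lambda>k l. fcoeff (\<sigma> k) (k - l))"
  define W where "W = (\<Sum>k\<in>T. bracket k powr (m - 1) * (cmod (f k))\<^sup>2)"
  define F where "F = (\<lambda>k. of_real (\<eta> k) * f k)"
  define E where "E = (\<lambda>k l. of_real (\<eta> k * (\<eta> k - \<eta> l)) * a k l)"
  have \<eta>: "0 \<le> \<eta> k" "\<eta> k \<le> 1" for k by (simp_all add: \<eta>_def)
  have "(\<Sum>k\<in>T. (\<eta> k)\<^sup>2 * ((\<Sum>l\<in>T. a k l * f l) * cnj (f k)))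
      = (\<Sum>k\<in>T. \<Sum>l\<in>T. a k l * (F l * cnj (F k)) + E k l * (f l * cnj (f k)))"
    unfolding sum_distrib_left sum_distrib_right
    by (intro sum.cong refl) (simp add: F_def E_def power2_eq_square algebra_simps)
  also have "\<dots> = (\<Sum>k\<in>T. \<Sum>l\<in>T. a k l * (F l * cnj (F k))) + (\<Sum>k\<in>T. \<Sum>l\<in>T. E k l * (f l * cnj (f k)))"
    by (simp only: sum.distrib)
  finally have eq: "Re (\<Sum>k\<in>T. (\<eta> k)\<^sup>2 * ((\<Sum>l\<in>T. a k l * f l) * cnj (f k)))
      = Re (\<Sum>k\<in>T. \<Sum>l\<in>T. a k l * (F l * cnj (F k))) + Re (\<Sum>k\<in>T. \<Sum>l\<in>T. E k l * (f l * cnj (f k)))"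
    by simp
  have sc: "0 \<le> symm_const TYPE('n) m" by (simp add: symm_const_def)
  have "(\<Sum>k\<in>T. bracket k powr (m - 1) * (cmod (F k))\<^sup>2) \<le> W"
    unfolding W_def
  proof (intro sum_mono mult_left_mono power_mono)
    show "cmod (F k) \<le> cmod (f k)" for k
      using \<eta>[of k] by (simp add: F_def norm_mult mult_left_le_one_le)
  qed auto
  then have "symm_const TYPE('n) m * A * C * (\<Sum>k\<in>T. bracket k powr (m - 1) * (cmod (F k))\<^sup>2)
      \<le> symm_const TYPE('n) m * A * C * W"
    using sc A C0 by (intro mult_left_mono) auto
  then have 1: "- (symm_const TYPE('n) m * A * C * W) \<le> Re (\<Sum>k\<in>T. \<Sum>l\<in>T. a k l * (F l * cnj (F k)))"
    using nonneg_symbol_form_lower_bound[OF cont pos K N A a0 a2 C T, of F] unfolding a_def by linarith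
  have "cmod (\<Sum>k\<in>T. \<Sum>l\<in>T. E k l * (f l * cnj (f k)))
    \<le> (4 * A) * C * (\<Sum>k\<in>T. bracket k powr (m - 1) * (cmod (f k))\<^sup>2)"
  proof (rule form_bound[OF C T])
    show "0 \<le> 4 * A" using A by simp
    fix k l
    have "cmod (E k l) = \<eta> k * \<bar>\<eta> k - \<eta> l\<bar> * cmod (a k l)"
      using \<eta>[of k] by (simp add: E_def norm_mult abs_mult del: of_real_mult of_real_diff)
    also have "\<dots> \<le> 1 * \<bar>\<eta> k - \<eta> l\<bar> * (A * bracket k powr m / bracket (k - l) ^ N)"
      using \<eta>[of k] a0[of k "k - l"] unfolding a_def by (intro mult_mono) auto
    also have "bracket k powr m = bracket k * bracket k powr (m - 1)"
      using powr_add[of "bracket k" 1 "m - 1"] by simp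
    also have "1 * \<bar>\<eta> k - \<eta> l\<bar> * (A * (bracket k * bracket k powr (m - 1)) / bracket (k - l) ^ N)
        = (bracket k * \<bar>\<eta> k - \<eta> l\<bar>) * (A * bracket k powr (m - 1) / bracket (k - l) ^ N)"
      by simp
    also have "\<dots> \<le> (4 * bracket (k - l)) * (A * bracket k powr (m - 1) / bracket (k - l) ^ N)"
      unfolding \<eta>_def using A by (intro mult_right_mono bracket_mult_cutoff_diff_le R) auto
    \<comment> \<open>The commutator loses a single power of \<open>bracket (k - l)\<close>;
      enlarging it to the symmetrization loss lets the same N serve both estimates.\<close>
    also have "\<dots> \<le> (4 * bracket (k - l) ^ (K + CARD('n) + 4)) * (A * bracket k powr (m - 1) / bracket (k - l) ^ N)"
      using A power_increasing[of 1 "K + CARD('n) + 4" "bracket (k - l)"]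
      by (intro mult_right_mono mult_left_mono) auto
    finally show "cmod (E k l) \<le> 4 * A *
        (bracket k powr ((m - 1) / 2) * bracket l powr ((m - 1) / 2)) / bracket (k - l) ^ (2 * CARD('n))"
      using K A by (intro weight_bound[where e = "K + CARD('n) + 4" and K = K]) (auto simp: N mult_ac)
  qed
  then have "cmod (\<Sum>k\<in>T. \<Sum>l\<in>T. E k l * (f l * cnj (f k))) \<le> 4 * A * C * W"
    by (simp add: W_def)
  then have 2: "- (4 * A * C * W) \<le> Re (\<Sum>k\<in>T. \<Sum>l\<in>T. E k l * (f l * cnj (f k)))"
    using abs_Re_le_cmod[of "\<Sum>k\<in>T. \<Sum>l\<in>T. E k l * (f l * cnj (f k))"] by linarith
  have "- ((symm_const TYPE('n) m + 4) * A * C * W)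
      = - (symm_const TYPE('n) m * A * C * W) + - (4 * A * C * W)"
    by (simp add: algebra_simps)
  then have "- ((symm_const TYPE('n) m + 4) * A * C * W)
      \<le> Re (\<Sum>k\<in>T. (\<eta> k)\<^sup>2 * ((\<Sum>l\<in>T. a k l * f l) * cnj (f k)))"
    using 1 2 unfolding eq by linarith
  then show ?thesis by (simp only: W_def \<eta>_def a_def)
qed

section \<open>The operator as an infinite matrix and the passage to the limit\<close>

lemma Op_eq_infsum: "Op \<sigma> f k = (\<Sum>\<^sub>\<infinity>l. fcoeff (\<sigma> k) (k - l) * f l)"
proof -
  have "torus_integral (\<lambda>x. echar k x * \<sigma> k x * (exp (- 2 * of_real pi * \<i> * of_real (rvec l \<bullet> x)) * f l))
      = fcoeff (\<sigma> k) (k - l) * f l" for l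
  proof -
    have "echar k x * \<sigma> k x * (exp (- 2 * of_real pi * \<i> * of_real (rvec l \<bullet> x)) * f l)
        = \<sigma> k x * echar (k - l) x * f l" for x
    proof -
      have "exp (- 2 * of_real pi * \<i> * of_real (rvec l \<bullet> x)) = echar (- l) x"
        by (simp add: echar_def rvec_minus)
      then show ?thesis by (simp add: echar_diff cnj_echar mult_ac)
    qed
    then show ?thesis by (simp only: fcoeff_def torus_integral_def integral_mult_left)
  qed
  then show ?thesis by (simp only: Op_def fourier_dist_def)
qed

text \<open>The weighted bound controls f pointwise by a power of the weight at l. Peetre's
  inequality trades it for the weight at k at the cost of K powers, and the remaining decay is
  summable, so each row converges absolutely even for growing f.\<close>

lemma Op_summable:
  fixes f :: "int ^ 'n::finite \<Rightarrow> complex"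
  assumes K: "\<bar>m\<bar> + 1 \<le> real K" and A: "0 \<le> A"
    and a0: "\<And>\<xi>. cmod (fcoeff u \<xi>) \<le> A * bracket k powr m / bracket \<xi> ^ (e + K + 2 * CARD('n))"
    and f: "\<And>l. bracket l powr (m - 1) * (cmod (f l))\<^sup>2 \<le> W"
  shows "(\<lambda>l. fcoeff u (k - l) * f l) summable_on UNIV"
proof -
  define s where "s = (m - 1) / 2"
  obtain C where C: "0 \<le> C"
    "\<And>S :: (int ^ 'n) set. finite S \<Longrightarrow> (\<Sum>h\<in>S. 1 / bracket h ^ (2 * CARD('n))) \<le> C"
    by (rule sum_bracket_bounded) auto
  have W: "0 \<le> W" using f[of 0] by (rule order_trans[rotated]) simp
  define B where "B = A * bracket k powr m * (sqrt W * bracket k powr (- s))"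
  have B: "0 \<le> B" using A W by (simp add: B_def)
  have term_le: "cmod (fcoeff u (k - l) * f l) \<le> B * (1 / bracket (k - l) ^ (2 * CARD('n)))" for l
  proof -
    have "(bracket l powr s * cmod (f l))\<^sup>2 \<le> W"
    proof -
      have "(bracket l powr s)\<^sup>2 = bracket l powr (m - 1)"
        by (simp add: power2_eq_square s_def flip: powr_add)
      with f[of l] show ?thesis by (simp add: power_mult_distrib)
    qed
    then have "bracket l powr s * cmod (f l) \<le> sqrt W" by (rule real_le_rsqrt)
    then have "bracket l powr (- s) * (bracket l powr s * cmod (f l)) \<le> bracket l powr (- s) * sqrt W"
      by (intro mult_left_mono) auto
    moreover have "bracket l powr (- s) * bracket l powr s = 1" by (simp flip: powr_add)
    ultimately have "cmod (f l) \<le> bracket l powr (- s) * sqrt W" by (simp flip: mult.assoc)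
    also have "\<dots> \<le> (bracket (l - k) ^ K * bracket k powr (- s)) * sqrt W"
      using K W by (intro mult_right_mono peetre) (auto simp: s_def)
    finally have "cmod (f l) \<le> bracket (k - l) ^ K * (sqrt W * bracket k powr (- s))"
      by (simp add: bracket_minus_commute mult_ac)
    then have "cmod (fcoeff u (k - l) * f l)
        \<le> (A * bracket k powr m / bracket (k - l) ^ (e + K + 2 * CARD('n))) * (bracket (k - l) ^ K * (sqrt W * bracket k powr (- s)))"
      unfolding norm_mult using A by (intro mult_mono a0) auto
    also have "\<dots> = B / bracket (k - l) ^ (e + 2 * CARD('n))"
      by (simp add: B_def power_add)
    also have "\<dots> \<le> B / bracket (k - l) ^ (2 * CARD('n))"
      using B by (intro divide_left_mono power_increasing mult_pos_pos zero_less_power) auto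
    finally show ?thesis by simp
  qed
  have "(\<lambda>l. B * (1 / bracket (k - l) ^ (2 * CARD('n)))) summable_on UNIV"
  proof (rule nonneg_bdd_above_summable_on)
    show "bdd_above (sum (\<lambda>l. B * (1 / bracket (k - l) ^ (2 * CARD('n)))) ` {F. F \<subseteq> UNIV \<and> finite F})"
    proof (rule bdd_aboveI2)
      fix F :: "(int ^ 'n) set" assume "F \<in> {F. F \<subseteq> UNIV \<and> finite F}"
      then have "finite ((\<lambda>l. k - l) ` F)" by simp
      from C(2)[OF this] have "(\<Sum>l\<in>F. 1 / bracket (k - l) ^ (2 * CARD('n))) \<le> C"
        by (subst (asm) sum.reindex) (auto simp: inj_on_def)
      then show "(\<Sum>l\<in>F. B * (1 / bracket (k - l) ^ (2 * CARD('n)))) \<le> B * C"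
        unfolding sum_distrib_left[symmetric] using B by (rule mult_left_mono)
    qed
  qed (use B in auto)
  then have "(\<lambda>l. cmod (fcoeff u (k - l) * f l)) summable_on UNIV"
    by (rule summable_on_comparison_test) (use term_le in auto)
  then show ?thesis by (rule abs_summable_summable)
qed

text \<open>Dominated convergence by hand: real summable families are absolutely summable, so
  outside a finite set \<open>U\<close> the absolute values add up to less than e / 2, and a cutoff
  equal to 1 on \<open>U\<close> can alter the sum only there.\<close>

lemma infsum_ge_of_cutoff_ge:
  fixes h :: "int ^ 'n::finite \<Rightarrow> real"
  assumes h: "h summable_on UNIV"
    and low: "\<And>R. 0 < R \<Longrightarrow> c \<le> (\<Sum>k\<in>{k. bracket k \<le> 2 * R}. (cutoff R k)\<^sup>2 * h k)"
  shows "c \<le> (\<Sum>\<^sub>\<infinity>k. h k)"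
proof (rule field_le_epsilon)
  fix e :: real assume e: "0 < e"
  have abs: "(\<lambda>k. \<bar>h k\<bar>) summable_on UNIV"
    using summable_on_iff_abs_summable_on_real[THEN iffD1, OF h] unfolding real_norm_def .
  have "(sum h \<longlongrightarrow> infsum h UNIV) (finite_subsets_at_top UNIV)"
    using h by (rule infsum_tendsto)
  then have "\<forall>\<^sub>F U in finite_subsets_at_top UNIV. sum h U < infsum h UNIV + e / 2"
    using e by (intro order_tendstoD(2)) auto
  moreover have "((\<lambda>U. \<Sum>k\<in>U. \<bar>h k\<bar>) \<longlongrightarrow> (\<Sum>\<^sub>\<infinity>k. \<bar>h k\<bar>)) (finite_subsets_at_top UNIV)"
    using abs by (rule infsum_tendsto)
  then have "\<forall>\<^sub>F U in finite_subsets_at_top UNIV. (\<Sum>\<^sub>\<infinity>k. \<bar>h k\<bar>) - e / 2 < (\<Sum>k\<in>U. \<bar>h k\<bar>)"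
    using e by (intro order_tendstoD(1)) auto
  ultimately have "\<forall>\<^sub>F U in finite_subsets_at_top UNIV. sum h U < infsum h UNIV + e / 2 \<and>
      (\<Sum>\<^sub>\<infinity>k. \<bar>h k\<bar>) - e / 2 < (\<Sum>k\<in>U. \<bar>h k\<bar>)"
    by (rule eventually_conj)
  then obtain U where U: "finite U" "sum h U < infsum h UNIV + e / 2"
      "(\<Sum>\<^sub>\<infinity>k. \<bar>h k\<bar>) - e / 2 < (\<Sum>k\<in>U. \<bar>h k\<bar>)"
    unfolding eventually_finite_subsets_at_top by blast
  \<comment> \<open>The sum dominates each single weight in \<open>U\<close>, so the cutoff equals 1
    on \<open>U\<close>; the summand 1 keeps \<open>R\<close> positive.\<close>
  define R where "R = 1 + (\<Sum>k\<in>U. bracket k)"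
  have R: "0 < R" by (auto simp: R_def intro!: add_pos_nonneg sum_nonneg)
  have UR: "bracket k \<le> R" if "k \<in> U" for k
    using member_le_sum[of k U bracket] that U(1) by (simp add: R_def)
  let ?S = "{k :: int ^ 'n. bracket k \<le> 2 * R}"
  have S: "finite ?S" "U \<subseteq> ?S" using UR R by (force simp: finite_bracket_le)+
  have "c \<le> (\<Sum>k\<in>?S. (cutoff R k)\<^sup>2 * h k)" by (rule low[OF R])
  also have "\<dots> = (\<Sum>k\<in>?S - U. (cutoff R k)\<^sup>2 * h k) + (\<Sum>k\<in>U. (cutoff R k)\<^sup>2 * h k)"
    by (rule sum.subset_diff[OF S(2,1)])
  also have "(\<Sum>k\<in>U. (cutoff R k)\<^sup>2 * h k) = sum h U"
    using UR R by (intro sum.cong refl) (simp add: cutoff_eq_1)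
  also have "(\<Sum>k\<in>?S - U. (cutoff R k)\<^sup>2 * h k) \<le> (\<Sum>k\<in>?S - U. \<bar>h k\<bar>)"
  proof (rule sum_mono)
    fix k
    have "(cutoff R k)\<^sup>2 * h k \<le> (cutoff R k)\<^sup>2 * \<bar>h k\<bar>" by (intro mult_left_mono) auto
    also have "\<dots> \<le> 1 * \<bar>h k\<bar>" by (intro mult_right_mono power_le_one) auto
    finally show "(cutoff R k)\<^sup>2 * h k \<le> \<bar>h k\<bar>" by simp
  qed
  also have "(\<Sum>k\<in>?S - U. \<bar>h k\<bar>) = (\<Sum>k\<in>?S. \<bar>h k\<bar>) - (\<Sum>k\<in>U. \<bar>h k\<bar>)"
    by (rule sum_diff[OF S])
  also have "(\<Sum>k\<in>?S. \<bar>h k\<bar>) \<le> (\<Sum>\<^sub>\<infinity>k. \<bar>h k\<bar>)"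
    by (rule finite_sum_le_infsum[OF abs S(1)]) auto
  finally show "c \<le> infsum h UNIV + e" using U by linarith
qed

theorem theorem5p10:
  fixes \<sigma> :: "int ^ 'n::finite \<Rightarrow> real ^ 'n \<Rightarrow> complex" and m :: real
  assumes "\<sigma> \<in> symbol_class m"
    and "\<And>k x. \<sigma> k x \<in> \<real>\<^sub>\<ge>\<^sub>0"
  shows "\<exists>C::real. \<forall>f \<in> l2s ((m - 1) / 2).
           Re (l2_pairing (Op \<sigma> f) f) \<ge> - C * (l2s_norm ((m - 1) / 2) f)\<^sup>2"
proof -
  have cont: "continuous_on UNIV (\<sigma> k)" for k
    using assms(1) unfolding symbol_class_def by (auto intro: smooth_imp_continuous)
  \<comment> \<open>K dominates the absolute values of m and m - 1, and of their halves: all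
    exponents to which Peetre's inequality is applied.\<close>
  define K where "K = nat \<lceil>\<bar>m\<bar> + 1\<rceil>"
  have K: "\<bar>m\<bar> + 1 \<le> real K" unfolding K_def by linarith
  define N where "N = (K + CARD('n) + 4) + K + 2 * CARD('n)"
  have "N > 0" by (simp add: N_def)
  then obtain A where A: "0 \<le> A"
    and a0: "\<And>k \<xi>. cmod (fcoeff (\<sigma> k) \<xi>) \<le> A * bracket k powr m / bracket \<xi> ^ N"
    and a2: "\<And>i j k \<xi>. cmod (diff_op i (diff_op j (\<lambda>p. fcoeff (\<sigma> p) \<xi>)) k)
       \<le> A * bracket k powr (m - 2) / bracket \<xi> ^ N"
    using symbol_class_fcoeff[OF assms(1), of N] unfolding bracket_def by blast
  obtain C where C: "0 \<le> C"
    "\<And>S :: (int ^ 'n) set. finite S \<Longrightarrow> (\<Sum>h\<in>S. 1 / bracket h ^ (2 * CARD('n))) \<le> C"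
    by (rule sum_bracket_bounded) auto
  define C' where "C' = (symm_const TYPE('n) m + 4) * A * C"
  have C': "0 \<le> C'" using A C by (simp add: C'_def symm_const_def)
  have "Re (l2_pairing (Op \<sigma> f) f) \<ge> - C' * (l2s_norm ((m - 1) / 2) f)\<^sup>2"
    if f: "f \<in> l2s ((m - 1) / 2)" for f
  proof -
    let ?w = "\<lambda>k. bracket k powr (m - 1) * (cmod (f k))\<^sup>2"
    define W where "W = infsum ?w UNIV"
    have s2: "2 * ((m - 1) / 2) = m - 1" by simp
    have w: "?w summable_on UNIV"
      using f unfolding l2s_def bracket_def mem_Collect_eq s2 .
    have norm: "(l2s_norm ((m - 1) / 2) f)\<^sup>2 = W"
      unfolding l2s_norm_def W_def bracket_def s2 by (simp add: infsum_nonneg)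
    have sum_le: "sum ?w S \<le> W" if "finite S" for S
      unfolding W_def by (rule finite_sum_le_infsum[OF w that]) auto
    have fW: "?w l \<le> W" for l using sum_le[of "{l}"] by simp
    define g where "g = (\<lambda>k. Op \<sigma> f k * cnj (f k))"
    have Op_lim: "((\<lambda>T. \<Sum>l\<in>T. fcoeff (\<sigma> k) (k - l) * f l) \<longlongrightarrow> Op \<sigma> f k) (finite_subsets_at_top UNIV)" for k
      unfolding Op_eq_infsum
      by (intro infsum_tendsto Op_summable[OF K A a0[unfolded N_def] fW])
    \<comment> \<open>Two limits are taken in this order: for fixed \<open>R\<close> finitely many
      rows survive and the columns exhaust the lattice; afterwards \<open>R\<close> grows. The
      constant depends on neither.\<close>
    have low: "- (C' * W) \<le> (\<Sum>k\<in>{k. bracket k \<le> 2 * R}. (cutoff R k)\<^sup>2 * Re (g k))" if R: "0 < R" for R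
    proof -
      let ?S = "{k :: int ^ 'n. bracket k \<le> 2 * R}"
      let ?q = "\<lambda>T. Re (\<Sum>k\<in>?S. (cutoff R k)\<^sup>2 * ((\<Sum>l\<in>T. fcoeff (\<sigma> k) (k - l) * f l) * cnj (f k)))"
      have "(?q \<longlongrightarrow> Re (\<Sum>k\<in>?S. (cutoff R k)\<^sup>2 * (Op \<sigma> f k * cnj (f k)))) (finite_subsets_at_top UNIV)"
        by (intro tendsto_intros Op_lim)
      moreover have "\<forall>\<^sub>F T in finite_subsets_at_top UNIV. - (C' * W) \<le> ?q T"
        unfolding eventually_finite_subsets_at_top
      proof (intro exI[of _ ?S] conjI allI impI)
        fix T assume "finite T \<and> ?S \<subseteq> T \<and> T \<subseteq> UNIV"
        then have T: "finite T" "?S \<subseteq> T" by auto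
        have "- (C' * W) \<le> - (C' * sum ?w T)"
          unfolding neg_le_iff_le by (intro mult_left_mono sum_le T C')
        also have "\<dots> \<le> Re (\<Sum>k\<in>T. (cutoff R k)\<^sup>2 * ((\<Sum>l\<in>T. fcoeff (\<sigma> k) (k - l) * f l) * cnj (f k)))"
          unfolding C'_def
          by (rule truncated_form_lower_bound[OF cont assms(2) K N_def A a0 a2 C T(1) R])
        \<comment> \<open>Rows beyond the support of the cutoff contribute nothing, so the range of
          k becomes independent of \<open>T\<close>.\<close>
        also have "(\<Sum>k\<in>T. (cutoff R k)\<^sup>2 * ((\<Sum>l\<in>T. fcoeff (\<sigma> k) (k - l) * f l) * cnj (f k)))
            = (\<Sum>k\<in>?S. (cutoff R k)\<^sup>2 * ((\<Sum>l\<in>T. fcoeff (\<sigma> k) (k - l) * f l) * cnj (f k)))"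
          using T R by (intro sum.mono_neutral_right) (auto simp: cutoff_eq_0)
        finally show "- (C' * W) \<le> ?q T" .
      qed (auto simp: finite_bracket_le)
      ultimately have "- (C' * W) \<le> Re (\<Sum>k\<in>?S. (cutoff R k)\<^sup>2 * (Op \<sigma> f k * cnj (f k)))"
        by (rule tendsto_lowerbound) simp
      also have "\<dots> = (\<Sum>k\<in>?S. (cutoff R k)\<^sup>2 * Re (g k))"
        unfolding Re_sum g_def by (intro sum.cong refl) (simp del: of_real_power flip: of_real_power)
      finally show ?thesis .
    qed
    have "- (C' * W) \<le> Re (infsum g UNIV)"
    proof (cases "g summable_on UNIV")
      case True
      then have "(\<lambda>k. Re (g k)) summable_on UNIV" by (rule summable_on_Re)
      from infsum_ge_of_cutoff_ge[OF this low] show ?thesis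
        using infsum_Re[OF True] by simp
    next
      \<comment> \<open>Without summability the pairing is 0 by convention, and the lower bound is
        not positive.\<close>
      case False
      have "0 \<le> W" using sum_le[of "{}"] by simp
      with C' False show ?thesis by (simp add: infsum_not_exists)
    qed
    then show ?thesis unfolding norm l2_pairing_def g_def by simp
  qed
  then show ?thesis by blast
qed

end
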